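(* Let $\{S_k; k\ge 1\}$ be a nondecreasing sequence of positive random variables. Suppose there exist a standard Wiener process $\{W(t); t\ge 0\}$ and two positive constants $\mu$ and $\sigma$ such that $$W_n(t):=\frac{S_{[nt]}-[nt]\mu}{\sigma\sqrt{n}}\ \xrightarrow{\mathscr D}\ W(t)\quad\text{in } D[0,1],\ \text{as } n\to\infty,$$ and $$\sup_n \frac{E|S_n-n\mu|}{\sqrt{n}}<\infty.$$ Then, with $\gamma=\mu/\sigma$, $$\left(\prod_{k=1}^{[nt]}\frac{S_k}{k\mu}\right)^{\gamma/\sqrt{n}}\ \xrightarrow{\mathscr D}\ \exp\left\{\int_0^t\frac{W(x)}{x}\,dx\right\}\quad\text{in } D[0,1],\ \text{as } n\to\infty.$$
   Context: $[x]$ denotes the integer part of $x$; an empty product (when $[nt]=0$) equals $1$. $D[0,1]$ is the Skorokhod space of càdlàg functions on $[0,1]$, and $\xrightarrow{\mathscr D}$ denotes convergence in distribution (weak convergence of the processes in $D[0,1]$). *)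

theory Defs
  imports "HOL-Probability.Probability"
begin

text \<open>Skorokhod space D[0,1]: real functions (on the reals; only the values on [0,1]
  matter) that are right-continuous on [0,1) and have left limits on (0,1].\<close>
definition cadlag01 :: "(real \<Rightarrow> real) \<Rightarrow> bool" where
  "cadlag01 x \<longleftrightarrow> (\<forall>t\<in>{0..<1}. continuous (at_right t) x) \<and>
                    (\<forall>t\<in>{0<..1}. \<exists>L. (x \<longlongrightarrow> L) (at_left t))"

definition D01 :: "(real \<Rightarrow> real) set" where
  "D01 = {x. cadlag01 x}"

definition skorokhod_Lambda :: "(real \<Rightarrow> real) set" where
  "skorokhod_Lambda = {l. strict_mono_on {0..1} l \<and> continuous_on {0..1} l \<and> l ` {0..1} = {0..1}}"

definition skorokhod_dist :: "(real \<Rightarrow> real) \<Rightarrow> (real \<Rightarrow> real) \<Rightarrow> real" where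
  "skorokhod_dist x y = Inf {max (SUP t\<in>{0..1}. \<bar>l t - t\<bar>) (SUP t\<in>{0..1}. \<bar>x t - y (l t)\<bar>) | l. l \<in> skorokhod_Lambda}"

definition skorokhod_continuous :: "((real \<Rightarrow> real) \<Rightarrow> real) \<Rightarrow> bool" where
  "skorokhod_continuous f \<longleftrightarrow> (\<forall>x\<in>D01. \<forall>e>0. \<exists>d>0. \<forall>y\<in>D01. skorokhod_dist x y < d \<longrightarrow> \<bar>f y - f x\<bar> < e)"

text \<open>Convergence in distribution in D[0,1] of processes X n (on the probability space M)
  to the process Y (on the probability space N): paths lie (a.s.) in D[0,1], and
  E f(X n) \<rightarrow> E f(Y) for every bounded Skorokhod-continuous functional f.
  Expectations are taken w.r.t. the completed measures (to avoid null-set measurability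
  artefacts).\<close>
definition conv_distr_D :: "'a measure \<Rightarrow> (nat \<Rightarrow> 'a \<Rightarrow> real \<Rightarrow> real) \<Rightarrow> 'b measure \<Rightarrow> ('b \<Rightarrow> real \<Rightarrow> real) \<Rightarrow> bool" where
  "conv_distr_D M X N Y \<longleftrightarrow>
     (\<forall>n. AE \<omega> in M. X n \<omega> \<in> D01) \<and> (AE \<omega> in N. Y \<omega> \<in> D01) \<and>
     (\<forall>f. skorokhod_continuous f \<and> (\<exists>B. \<forall>x\<in>D01. \<bar>f x\<bar> \<le> B) \<longrightarrow>
        (\<lambda>n. integral\<^sup>L (completion M) (\<lambda>\<omega>. f (X n \<omega>)))
          \<longlonglongrightarrow> integral\<^sup>L (completion N) (\<lambda>\<omega>. f (Y \<omega>)))"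

definition standard_wiener_process :: "'b measure \<Rightarrow> (real \<Rightarrow> 'b \<Rightarrow> real) \<Rightarrow> bool" where
  "standard_wiener_process N W \<longleftrightarrow>
     prob_space N \<and>
     (\<forall>t\<ge>0. W t \<in> borel_measurable N) \<and>
     (\<forall>\<omega>\<in>space N. W 0 \<omega> = 0 \<and> continuous_on {0..} (\<lambda>t. W t \<omega>)) \<and>
     (\<forall>s t. 0 \<le> s \<and> s < t \<longrightarrow>
        distributed N lborel (\<lambda>\<omega>. W t \<omega> - W s \<omega>) (normal_density 0 (sqrt (t - s)))) \<and>
     (\<forall>m (u :: nat \<Rightarrow> real). 0 \<le> u 0 \<and> (\<forall>i<m. u i < u (Suc i)) \<longrightarrow>
        prob_space.indep_vars N (\<lambda>_. borel) (\<lambda>i \<omega>. W (u (Suc i)) \<omega> - W (u i) \<omega>) {..<m})"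

end

theory Submission
  imports Defs
begin

text \<open>
  Write \<open>R k = S k / (k \<mu>) - 1\<close>. The moment bound along fourth powers and monotonicity of \<open>S\<close> give
  \<open>R k \<longrightarrow> 0\<close> almost surely, so \<open>ln (1 + R k) - R k\<close> is almost surely \<open>o(\<bar>R k\<bar>)\<close>, while
  \<open>n\<^sup>-\<^sup>1\<^sup>/\<^sup>2 (\<bar>R 1\<bar> + ... + \<bar>R n\<bar>)\<close> is bounded in \<open>L\<^sup>1\<close>. Hence the logarithm of the product process is
  uniformly close in probability to the integral of \<open>W\<^sub>n(x) / x\<close>, and the part of that integral over
  \<open>{0..\<epsilon>}\<close> is of order \<open>\<epsilon>\<^sup>1\<^sup>/\<^sup>2\<close> in \<open>L\<^sup>1\<close>. The integral over \<open>{\<epsilon>..t}\<close> is a continuous map from the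
  Skorokhod topology to the uniform one, so it converges by hypothesis, and \<open>\<epsilon>\<close> is sent to \<open>0\<close>.
  Test functionals need not be uniformly continuous; they are replaced by their Lipschitz
  envelopes \<open>inf\<^sub>y (g y + k \<parallel>x - y\<parallel>)\<close> in the uniform norm, which increase to \<open>g\<close>; applying the
  resulting lower bound to \<open>g\<close> and \<open>- g\<close> gives the limit.
\<close>

section \<open>Paths in the Skorokhod space\<close>

text \<open>A Bochner integral of a non-measurable function is 0 by convention, so each expectation
  needs measurability of its functional before it can be estimated, and a test functional comes with
  continuity only. Uniform-norm continuity is the property carried along because it is inherited by
  f composed with exp and still suffices for measurability. Only first absolute moments are
  available, so the sums of \<open>(R k)\<^sup>2\<close> have no controllable mean. The logarithmic
  error is therefore measured against |R k|, whose mean is O(k^(-1/2)); the same rate makes the part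
  below \<epsilon> of order \<epsilon>^(1/2). Along j^4 the means are O(j^(-2)), a summable rate,
  while consecutive indices have ratio tending to 1; squares would only give the harmonic series.
  Continuity of g at a random path gives no modulus common to all paths, so small mean distance
  alone says nothing about g. A Lipschitz constant turns mean distance directly into an error of the
  expectation, with no compactness or tightness of the paths. As the envelopes lie below g, only
  lower bounds pass from them to g.\<close>

lemma cadlag_half_neighbourhoods:
  assumes x: "x \<in> D01" and e: "0 < e" and s: "s \<in> {0..1}"
  shows "\<exists>d>0. (\<forall>u\<in>{0..1}. \<forall>v\<in>{0..1}. s < u \<and> u < s + d \<and> s < v \<and> v < s + d \<longrightarrow> \<bar>x u - x v\<bar> < e) \<and>
               (\<forall>u\<in>{0..1}. \<forall>v\<in>{0..1}. s - d < u \<and> u < s \<and> s - d < v \<and> v < s \<longrightarrow> \<bar>x u - x v\<bar> < e)"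
proof -
  have R: "\<exists>d>0. \<forall>u\<in>{0..1}. \<forall>v\<in>{0..1}. s < u \<and> u < s + d \<and> s < v \<and> v < s + d \<longrightarrow> \<bar>x u - x v\<bar> < e"
  proof (cases "s < 1")
    case True
    with x s have "(x \<longlongrightarrow> x s) (at_right s)"
      by (auto simp: D01_def cadlag01_def continuous_within)
    then have "eventually (\<lambda>u. dist (x u) (x s) < e / 2) (at_right s)"
      using e by (intro tendstoD) auto
    then obtain b where b: "b > s" "\<And>u. u > s \<Longrightarrow> u < b \<Longrightarrow> \<bar>x u - x s\<bar> < e / 2"
      by (auto simp: eventually_at_right[OF True] dist_real_def)
    show ?thesis
    proof (intro exI[of _ "b - s"] conjI ballI impI)
      fix u v assume "s < u \<and> u < s + (b - s) \<and> s < v \<and> v < s + (b - s)"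
      then show "\<bar>x u - x v\<bar> < e" using b(2)[of u] b(2)[of v] by linarith
    qed (use b in auto)
  \<comment> \<open>No point of [0,1] lies to the right of s = 1, so any radius serves; the left
    side at s = 0 is treated in the same way below.\<close>
  qed (use s in \<open>auto intro!: exI[of _ 1]\<close>)
  have L: "\<exists>d>0. \<forall>u\<in>{0..1}. \<forall>v\<in>{0..1}. s - d < u \<and> u < s \<and> s - d < v \<and> v < s \<longrightarrow> \<bar>x u - x v\<bar> < e"
  proof (cases "0 < s")
    case True
    with x s have "\<exists>l. (x \<longlongrightarrow> l) (at_left s)"
      by (simp add: D01_def cadlag01_def)
    then obtain l where "(x \<longlongrightarrow> l) (at_left s)" ..
    then have "eventually (\<lambda>u. dist (x u) l < e / 2) (at_left s)"
      using e by (intro tendstoD) auto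
    then obtain b where b: "b < s" "\<And>u. u < s \<Longrightarrow> b < u \<Longrightarrow> \<bar>x u - l\<bar> < e / 2"
      by (auto simp: eventually_at_left[OF True] dist_real_def)
    show ?thesis
    proof (intro exI[of _ "s - b"] conjI ballI impI)
      fix u v assume "s - (s - b) < u \<and> u < s \<and> s - (s - b) < v \<and> v < s"
      then show "\<bar>x u - x v\<bar> < e" using b(2)[of u] b(2)[of v] by linarith
    qed (use b in auto)
  qed (use s in \<open>auto intro!: exI[of _ 1]\<close>)
  from R L obtain d1 d2 where d: "d1 > 0" "d2 > 0"
    "\<forall>u\<in>{0..1}. \<forall>v\<in>{0..1}. s < u \<and> u < s + d1 \<and> s < v \<and> v < s + d1 \<longrightarrow> \<bar>x u - x v\<bar> < e"
    "\<forall>u\<in>{0..1}. \<forall>v\<in>{0..1}. s - d2 < u \<and> u < s \<and> s - d2 < v \<and> v < s \<longrightarrow> \<bar>x u - x v\<bar> < e"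
    by metis
  show ?thesis
  proof (intro exI[of _ "min d1 d2"] conjI ballI impI)
    fix u v :: real assume uv: "u \<in> {0..1}" "v \<in> {0..1}"
    show "\<bar>x u - x v\<bar> < e" if "s < u \<and> u < s + min d1 d2 \<and> s < v \<and> v < s + min d1 d2"
      using that by (intro d(3)[rule_format, OF uv]) auto
    show "\<bar>x u - x v\<bar> < e" if "s - min d1 d2 < u \<and> u < s \<and> s - min d1 d2 < v \<and> v < s"
      using that by (intro d(4)[rule_format, OF uv]) auto
  qed (use d in auto)
qed

text \<open>The centres are excluded from both half-neighbourhoods: a cadlag path may jump at a
  centre, and small oscillation is only asked for on either side of it.\<close>

definition oscillation_cover :: "(real \<Rightarrow> real) \<Rightarrow> real \<Rightarrow> real set \<Rightarrow> (real \<Rightarrow> real) \<Rightarrow> bool" where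
  "oscillation_cover x e F d \<longleftrightarrow> finite F \<and> F \<subseteq> {0..1} \<and> (\<forall>t\<in>{0..1}. \<exists>s\<in>F. \<bar>t - s\<bar> < d s) \<and>
     (\<forall>s\<in>F. \<forall>u\<in>{0..1}. \<forall>v\<in>{0..1}. s < u \<and> u < s + d s \<and> s < v \<and> v < s + d s \<longrightarrow> \<bar>x u - x v\<bar> < e) \<and>
     (\<forall>s\<in>F. \<forall>u\<in>{0..1}. \<forall>v\<in>{0..1}. s - d s < u \<and> u < s \<and> s - d s < v \<and> v < s \<longrightarrow> \<bar>x u - x v\<bar> < e)"

lemma oscillation_coverD:
  assumes "oscillation_cover x e F d"
  shows "finite F" "F \<subseteq> {0..1}" "\<And>t. t \<in> {0..1} \<Longrightarrow> \<exists>s\<in>F. \<bar>t - s\<bar> < d s"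
    "\<And>s u v. s \<in> F \<Longrightarrow> u \<in> {0..1} \<Longrightarrow> v \<in> {0..1} \<Longrightarrow> s < u \<Longrightarrow> u < s + d s \<Longrightarrow> s < v \<Longrightarrow> v < s + d s \<Longrightarrow> \<bar>x u - x v\<bar> < e"
    "\<And>s u v. s \<in> F \<Longrightarrow> u \<in> {0..1} \<Longrightarrow> v \<in> {0..1} \<Longrightarrow> s - d s < u \<Longrightarrow> u < s \<Longrightarrow> s - d s < v \<Longrightarrow> v < s \<Longrightarrow> \<bar>x u - x v\<bar> < e"
  using assms by (simp_all add: oscillation_cover_def)

lemma cadlag_finite_cover:
  assumes x: "x \<in> D01" and e: "0 < e"
  shows "\<exists>F d. oscillation_cover x e F d"
proof -
  have "\<forall>s\<in>{0..1}. \<exists>d>0. 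
      (\<forall>u\<in>{0..1}. \<forall>v\<in>{0..1}. s < u \<and> u < s + d \<and> s < v \<and> v < s + d \<longrightarrow> \<bar>x u - x v\<bar> < e) \<and>
      (\<forall>u\<in>{0..1}. \<forall>v\<in>{0..1}. s - d < u \<and> u < s \<and> s - d < v \<and> v < s \<longrightarrow> \<bar>x u - x v\<bar> < e)"
    by (intro ballI cadlag_half_neighbourhoods[OF x e])
  from bchoice[OF this] obtain d where d: "\<forall>s\<in>{0..1}. d s > 0 \<and> 
      (\<forall>u\<in>{0..1}. \<forall>v\<in>{0..1}. s < u \<and> u < s + d s \<and> s < v \<and> v < s + d s \<longrightarrow> \<bar>x u - x v\<bar> < e) \<and>
      (\<forall>u\<in>{0..1}. \<forall>v\<in>{0..1}. s - d s < u \<and> u < s \<and> s - d s < v \<and> v < s \<longrightarrow> \<bar>x u - x v\<bar> < e)"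
    by (elim exE)
  have "compact {0..1::real}" by simp
  then obtain F where F: "F \<subseteq> {0..1}" "finite F" "{0..1} \<subseteq> (\<Union>s\<in>F. ball s (d s))"
    by (rule compactE_image[of _ "{0..1}" "\<lambda>s. ball s (d s)"]) (use d in auto)
  have "\<exists>s\<in>F. \<bar>t - s\<bar> < d s" if "t \<in> {0..1}" for t
  proof -
    obtain s where "s \<in> F" "t \<in> ball s (d s)" using F(3) \<open>t \<in> {0..1}\<close> by blast
    then show ?thesis by (intro bexI[of _ s]) (auto simp: dist_real_def)
  qed
  moreover have "d s > 0 \<and> 
      (\<forall>u\<in>{0..1}. \<forall>v\<in>{0..1}. s < u \<and> u < s + d s \<and> s < v \<and> v < s + d s \<longrightarrow> \<bar>x u - x v\<bar> < e) \<and>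
      (\<forall>u\<in>{0..1}. \<forall>v\<in>{0..1}. s - d s < u \<and> u < s \<and> s - d s < v \<and> v < s \<longrightarrow> \<bar>x u - x v\<bar> < e)" if "s \<in> F" for s
    by (rule bspec[OF d subsetD[OF F(1) that]])
  ultimately have "oscillation_cover x e F d"
    using F(1,2) unfolding oscillation_cover_def by simp
  then show ?thesis by blast
qed

lemma cadlag_bounded:
  assumes x: "x \<in> D01"
  shows "\<exists>B>0. \<forall>t\<in>{0..1}. \<bar>x t\<bar> \<le> B"
proof -
  obtain F d where "oscillation_cover x 1 F d"
    using cadlag_finite_cover[OF x zero_less_one] by blast
  note F = oscillation_coverD[OF this]
  have bdd: "bounded (x ` A)" if "A \<subseteq> {0..1}" "\<And>u v. u \<in> A \<Longrightarrow> v \<in> A \<Longrightarrow> \<bar>x u - x v\<bar> < 1" for A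
  proof (cases "A = {}")
    case False
    then obtain v where v: "v \<in> A" by auto
    have "norm (x u) \<le> \<bar>x v\<bar> + 1" if "u \<in> A" for u
      using \<open>\<And>u v. u \<in> A \<Longrightarrow> v \<in> A \<Longrightarrow> \<bar>x u - x v\<bar> < 1\<close>[OF that v] by auto
    then show ?thesis unfolding bounded_iff by blast
  qed auto
  have "bounded (x ` ({s} \<union> ({0..1} \<inter> {s<..<s + d s}) \<union> ({0..1} \<inter> {s - d s<..<s})))" if "s \<in> F" for s
    unfolding image_Un bounded_Un using F(4,5)[OF that] subsetD[OF F(2) that] by (intro conjI bdd) auto
  then have "bounded (\<Union>s\<in>F. x ` ({s} \<union> ({0..1} \<inter> {s<..<s + d s}) \<union> ({0..1} \<inter> {s - d s<..<s})))"
    using F(1) by (intro bounded_UN) auto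
  moreover have "x ` {0..1} \<subseteq> (\<Union>s\<in>F. x ` ({s} \<union> ({0..1} \<inter> {s<..<s + d s}) \<union> ({0..1} \<inter> {s - d s<..<s})))"
  proof safe
    fix t :: real assume t: "t \<in> {0..1}"
    then obtain s where "s \<in> F" "\<bar>t - s\<bar> < d s" using F(3) by blast
    with t show "x t \<in> (\<Union>s\<in>F. x ` ({s} \<union> ({0..1} \<inter> {s<..<s + d s}) \<union> ({0..1} \<inter> {s - d s<..<s})))"
      by (cases t s rule: linorder_cases) (auto intro!: bexI[of _ s])
  qed
  ultimately have "bounded (x ` {0..1})" by (rule bounded_subset)
  then show ?thesis unfolding bounded_pos by auto
qed

text \<open>Away from the centres of a cover of oscillation e the path varies by less than e near
  each point. So the points where this fails lie in a finite set, and e runs through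
  1/(m+1).\<close>

lemma cadlag_countable_discontinuities:
  assumes x: "x \<in> D01"
  shows "countable {t\<in>{0<..<1}. \<not> isCont x t}"
proof -
  have "\<exists>F. finite F \<and> (\<forall>t\<in>{0<..<1} - F. \<exists>r>0. \<forall>u. \<bar>u - t\<bar> < r \<longrightarrow> \<bar>x u - x t\<bar> < e)" if "e > 0" for e
  proof -
    obtain F d where "oscillation_cover x e F d"
      using cadlag_finite_cover[OF x \<open>e > 0\<close>] by blast
    note F = oscillation_coverD[OF this]
    show ?thesis
    proof (intro exI[of _ F] conjI ballI)
      fix t assume t: "t \<in> {0<..<1} - F"
      then obtain s where s: "s \<in> F" "\<bar>t - s\<bar> < d s" using F(3)[of t] by auto
      \<comment> \<open>A radius r around t stays in [0,1], on one side of the centre s, and within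
        the neighbourhood of s.\<close>
      define r where "r = Min {t, 1 - t, \<bar>t - s\<bar>, d s - \<bar>t - s\<bar>}"
      have "t \<noteq> s" using s t by auto
      then have "r > 0" using t s by (auto simp: r_def)
      moreover have "\<bar>x u - x t\<bar> < e" if "\<bar>u - t\<bar> < r" for u
      proof -
        have u: "u \<in> {0..1}" "\<bar>u - t\<bar> < \<bar>t - s\<bar>" "\<bar>u - t\<bar> < d s - \<bar>t - s\<bar>"
          using that t by (auto simp: r_def)
        show ?thesis
        proof (cases "s < t")
          case True
          with u s t show ?thesis by (intro F(4)[of s u t]) auto
        next
          case False
          with u s t \<open>t \<noteq> s\<close> show ?thesis by (intro F(5)[of s u t]) auto
        qed
      qed
      ultimately show "\<exists>r>0. \<forall>u. \<bar>u - t\<bar> < r \<longrightarrow> \<bar>x u - x t\<bar> < e" by blast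
    qed (fact F(1))
  qed
  then obtain F where F: "\<And>e. e > 0 \<Longrightarrow> finite (F e)"
    "\<And>e t. e > 0 \<Longrightarrow> t \<in> {0<..<1} - F e \<Longrightarrow> \<exists>r>0. \<forall>u. \<bar>u - t\<bar> < r \<longrightarrow> \<bar>x u - x t\<bar> < e"
    by metis
  have "{t\<in>{0<..<1}. \<not> isCont x t} \<subseteq> (\<Union>m::nat. F (1 / Suc m))"
  proof (rule ccontr)
    assume "\<not> ?thesis"
    then obtain t where t: "t \<in> {0<..<1}" "\<not> isCont x t" "\<And>m::nat. t \<notin> F (1 / Suc m)" by auto
    have "isCont x t"
      unfolding continuous_at_eps_delta
    proof safe
      fix e :: real assume "e > 0"
      then obtain m where m: "1 / Suc m < e" using nat_approx_posE by blast
      then show "\<exists>d>0. \<forall>x'. dist x' t < d \<longrightarrow> dist (x x') (x t) < e"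
        using F(2)[of "1 / Suc m" t] t by (fastforce simp: dist_real_def)
    qed
    with t show False by simp
  qed
  moreover have "countable (\<Union>m::nat. F (1 / Suc m))"
    by (rule countable_UN) (auto intro!: countable_finite F(1))
  ultimately show ?thesis by (rule countable_subset)
qed

lemma cadlag_AE_isCont:
  assumes x: "x \<in> D01"
  shows "AE t in lborel. t \<in> {0..1} \<longrightarrow> isCont x t"
proof (rule AE_I')
  have "countable ({t\<in>{0<..<1}. \<not> isCont x t} \<union> {0,1})"
    using cadlag_countable_discontinuities[OF x] by auto
  then show "{t\<in>{0<..<1}. \<not> isCont x t} \<union> {0,1} \<in> null_sets lborel"
    by (rule countable_imp_null_set_lborel)
qed auto

text \<open>Continuity outside a countable set gives Borel measurability. Values of x outside [0,1]
  are arbitrary, hence the indicator, whose own jumps put 0 and 1 among the exceptions.\<close>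

lemma cadlag_measurable:
  assumes x: "x \<in> D01"
  shows "(\<lambda>t. indicator {0..1} t * x t) \<in> borel_measurable borel"
proof (rule borel_measurable_continuous_countable_exceptions)
  let ?X = "{t\<in>{0<..<1}. \<not> isCont x t} \<union> {0,1}"
  show "countable ?X"
    using cadlag_countable_discontinuities[OF x] by auto
  have "isCont (\<lambda>t. indicator {0..1} t * x t) s" if "s \<notin> ?X" for s
  proof (cases "s \<in> {0<..<1}")
    case True
    then have ev: "eventually (\<lambda>t. t \<in> {0<..<1}) (nhds s)"
      by (intro eventually_nhds_in_open) auto
    have "isCont (\<lambda>t. indicator {0..1} t * x t) s = isCont x s"
      by (rule isCont_cong, rule eventually_mono[OF ev]) auto
    with True that show ?thesis by auto
  next
    case False
    with that have "s \<in> - {0..1}" by auto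
    then have ev: "eventually (\<lambda>t. t \<in> - {0..1}) (nhds s)"
      by (intro eventually_nhds_in_open) auto
    have "isCont (\<lambda>t. indicator {0..1} t * x t) s = isCont (\<lambda>t. 0::real) s"
      by (rule isCont_cong, rule eventually_mono[OF ev]) auto
    then show ?thesis by auto
  qed
  then show "continuous_on (- ?X) (\<lambda>t. indicator {0..1} t * x t)"
    by (intro continuous_at_imp_continuous_on) blast
qed

lemma continuous_imp_D01:
  assumes "continuous_on {0..1} x" shows "x \<in> D01"
  unfolding D01_def cadlag01_def
proof (safe, goal_cases)
  case (1 t)
  then have "continuous (at t within {0..1}) x"
    using assms by (auto simp: continuous_on_eq_continuous_within)
  then have "continuous (at t within {t..1}) x" 
    by (rule continuous_within_subset) (use 1 in auto)
  then show ?case using 1 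
    by (simp add: at_within_Icc_at_right continuous_within)
next
  case (2 t)
  then have "continuous (at t within {0..1}) x"
    using assms by (auto simp: continuous_on_eq_continuous_within)
  then have "continuous (at t within {0..t}) x" 
    by (rule continuous_within_subset) (use 2 in auto)
  then show ?case using 2
    by (auto simp: at_within_Icc_at_left continuous_within)
qed

lemma D01_compose_continuous:
  assumes x: "x \<in> D01" and h: "continuous_on UNIV (h :: real \<Rightarrow> real)"
  shows "(\<lambda>t. h (x t)) \<in> D01"
  unfolding D01_def cadlag01_def
proof (safe, goal_cases)
  case (1 t)
  then have "(x \<longlongrightarrow> x t) (at_right t)"
    using x by (auto simp: D01_def cadlag01_def continuous_within)
  then show ?case using h
    by (auto simp: continuous_within continuous_on_eq_continuous_at intro: isCont_tendsto_compose)
next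
  case (2 t)
  then have "\<exists>l. (x \<longlongrightarrow> l) (at_left t)"
    using x by (simp add: D01_def cadlag01_def)
  then obtain l where "(x \<longlongrightarrow> l) (at_left t)" ..
  then have "((\<lambda>t. h (x t)) \<longlongrightarrow> h l) (at_left t)"
    using h by (auto simp: continuous_on_eq_continuous_at intro: isCont_tendsto_compose)
  then show ?case by blast
qed

lemma grid_step_in_D01:
  fixes z :: "nat \<Rightarrow> real"
  shows "(\<lambda>t. z (nat \<lfloor>real n * t\<rfloor>)) \<in> D01"
proof (cases "n = 0")
  case True
  then show ?thesis by (auto intro!: continuous_imp_D01)
next
  case False
  then have n: "real n > 0" by auto
  have R: "eventually (\<lambda>u. \<lfloor>real n * u\<rfloor> = \<lfloor>real n * t\<rfloor>) (at_right t)" for t :: real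
  proof (rule eventually_at_rightI)
    show "t < (of_int \<lfloor>real n * t\<rfloor> + 1) / real n"
      using n by (simp add: pos_less_divide_eq mult.commute)
    fix u assume "u \<in> {t<..<(of_int \<lfloor>real n * t\<rfloor> + 1) / real n}"
    then have "real n * t < real n * u" "real n * u < of_int \<lfloor>real n * t\<rfloor> + 1" using n by (auto simp: field_simps)
    then show "\<lfloor>real n * u\<rfloor> = \<lfloor>real n * t\<rfloor>" by linarith
  qed
  \<comment> \<open>The index just to the left of t is
    \<open>\<lceil>real n * t\<rceil> - 1\<close>: at a grid point it is one less than the floor,
    elsewhere it equals the floor.\<close>
  have L: "eventually (\<lambda>u. \<lfloor>real n * u\<rfloor> = \<lceil>real n * t\<rceil> - 1) (at_left t)" for t :: real
  proof (rule eventually_at_leftI)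
    show "(of_int \<lceil>real n * t\<rceil> - 1) / real n < t"
      using n ceiling_correct[of "real n * t"] by (simp add: pos_divide_less_eq mult.commute)
    fix u assume "u \<in> {(of_int \<lceil>real n * t\<rceil> - 1) / real n<..<t}"
    then have "real n * u < real n * t" "of_int \<lceil>real n * t\<rceil> - 1 < real n * u" using n by (auto simp: field_simps)
    then show "\<lfloor>real n * u\<rfloor> = \<lceil>real n * t\<rceil> - 1" by linarith
  qed
  show ?thesis
    unfolding D01_def cadlag01_def continuous_within
  proof (safe, goal_cases)
    case (1 t)
    show ?case by (rule tendsto_eventually, rule eventually_mono[OF R[of t]]) simp
  next
    case (2 t)
    show ?case
      by (rule exI[of _ "z (nat (\<lceil>real n * t\<rceil> - 1))"], rule tendsto_eventually, rule eventually_mono[OF L[of t]]) simp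
  qed
qed

section \<open>Comparing the Skorokhod distance with pointwise distances\<close>

lemma skorokhod_dist_le:
  assumes "0 \<le> r" "\<And>t. t \<in> {0..1} \<Longrightarrow> \<bar>x t - y t\<bar> \<le> r"
  shows "skorokhod_dist x y \<le> r"
proof -
  let ?A = "{max (SUP t\<in>{0..1}. \<bar>l t - t\<bar>) (SUP t\<in>{0..1}. \<bar>x t - y (l t)\<bar>) | l. l \<in> skorokhod_Lambda}"
  let ?v = "max (SUP t\<in>{0..1::real}. \<bar>id t - t\<bar>) (SUP t\<in>{0..1}. \<bar>x t - y (id t)\<bar>)"
  have "id \<in> skorokhod_Lambda"
    by (auto simp: skorokhod_Lambda_def strict_mono_on_def)
  then have "?v \<in> ?A" by blast
  \<comment> \<open>An infimum of reals is informative only for a set bounded below. The time-change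
    entry of the maximum supplies the bound 0, since the other supremum may range over an unbounded
    function.\<close>
  moreover have "bdd_below ?A"
  proof (rule bdd_belowI)
    fix a assume "a \<in> ?A"
    then obtain l where l: "l \<in> skorokhod_Lambda" and a: "a = max (SUP t\<in>{0..1}. \<bar>l t - t\<bar>) (SUP t\<in>{0..1}. \<bar>x t - y (l t)\<bar>)"
      by blast
    have "\<bar>l t - t\<bar> \<le> 1" if "t \<in> {0..1}" for t
    proof -
      have "l t \<in> {0..1}" using l that by (auto simp: skorokhod_Lambda_def)
      with that show ?thesis by auto
    qed
    then have "\<bar>l 0 - 0\<bar> \<le> (SUP t\<in>{0..1}. \<bar>l t - t\<bar>)"
      by (intro cSUP_upper) (auto intro!: bdd_aboveI2[of _ _ 1])
    then show "0 \<le> a" unfolding a by auto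
  qed
  ultimately have "skorokhod_dist x y \<le> ?v"
    unfolding skorokhod_dist_def by (intro cInf_lower)
  also have "?v \<le> r" using assms by (auto intro!: cSUP_least)
  finally show ?thesis .
qed

text \<open>Of the time change only surjectivity is kept; this suffices for all integral functionals.\<close>
lemma skorokhod_dist_lessD:
  assumes x: "x \<in> D01" and y: "y \<in> D01" and d: "skorokhod_dist x y < d" and s: "s \<in> {0..1}"
  shows "\<exists>t\<in>{0..1}. \<bar>t - s\<bar> < d \<and> \<bar>x t - y s\<bar> < d"
proof -
  let ?A = "{max (SUP t\<in>{0..1}. \<bar>l t - t\<bar>) (SUP t\<in>{0..1}. \<bar>x t - y (l t)\<bar>) | l. l \<in> skorokhod_Lambda}"
  have "id \<in> skorokhod_Lambda"
    by (auto simp: skorokhod_Lambda_def strict_mono_on_def)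
  then have "?A \<noteq> {}" by blast
  from cInf_lessD[OF this d[unfolded skorokhod_dist_def]] obtain l where l: "l \<in> skorokhod_Lambda"
    and lt: "(SUP t\<in>{0..1}. \<bar>l t - t\<bar>) < d" "(SUP t\<in>{0..1}. \<bar>x t - y (l t)\<bar>) < d"
    by auto
  have l01: "l t \<in> {0..1}" if "t \<in> {0..1}" for t
    using l that by (auto simp: skorokhod_Lambda_def)
  from l s obtain t where t: "t \<in> {0..1}" "l t = s"
    by (auto simp: skorokhod_Lambda_def image_iff set_eq_iff) (metis atLeastAtMost_iff)
  \<comment> \<open>Boundedness of both paths makes the supremum of their difference a genuine upper
    bound.\<close>
  obtain Bx By where B: "\<And>t. t \<in> {0..1} \<Longrightarrow> \<bar>x t\<bar> \<le> Bx" "\<And>t. t \<in> {0..1} \<Longrightarrow> \<bar>y t\<bar> \<le> By"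
    using cadlag_bounded[OF x] cadlag_bounded[OF y] by blast
  have "\<bar>l t - t\<bar> \<le> 1" if "t \<in> {0..1}" for t
    using l01[OF that] that by auto
  then have "\<bar>l t - t\<bar> \<le> (SUP t\<in>{0..1}. \<bar>l t - t\<bar>)"
    using t by (intro cSUP_upper) (auto intro!: bdd_aboveI2[of _ _ 1])
  moreover have "\<bar>x t - y (l t)\<bar> \<le> Bx + By" if "t \<in> {0..1}" for t
    using B(1)[OF that] B(2)[OF l01[OF that]] by auto
  then have "\<bar>x t - y (l t)\<bar> \<le> (SUP t\<in>{0..1}. \<bar>x t - y (l t)\<bar>)"
    using t by (intro cSUP_upper bdd_aboveI2) auto
  ultimately show ?thesis using t lt by (intro bexI[of _ t]) auto
qed

section \<open>Uniform-norm functionals and the truncated integral\<close>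

definition unif_close :: "real \<Rightarrow> (real \<Rightarrow> real) \<Rightarrow> (real \<Rightarrow> real) \<Rightarrow> bool" where
  "unif_close r x y \<longleftrightarrow> (\<forall>t\<in>{0..1}. \<bar>x t - y t\<bar> \<le> r)"

text \<open>Continuity at each path for the uniform norm, not uniform continuity: d may depend on
  x.\<close>

definition unif_continuous_D :: "((real \<Rightarrow> real) \<Rightarrow> real) \<Rightarrow> bool" where
  "unif_continuous_D g \<longleftrightarrow> (\<forall>x\<in>D01. \<forall>e>0. \<exists>d>0. \<forall>y\<in>D01. unif_close d x y \<longrightarrow> \<bar>g y - g x\<bar> < e)"

text \<open>The set-valued formulation avoids suprema of possibly unbounded functions.\<close>
definition lip_envelope :: "real \<Rightarrow> ((real \<Rightarrow> real) \<Rightarrow> real) \<Rightarrow> (real \<Rightarrow> real) \<Rightarrow> real" where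
  "lip_envelope k g x = Inf {g y + k * r | y r. y \<in> D01 \<and> 0 \<le> r \<and> unif_close r x y}"

lemma unif_close_refl: "0 \<le> r \<Longrightarrow> unif_close r x x"
  by (simp add: unif_close_def)

lemma unif_close_sym: "unif_close r x y \<Longrightarrow> unif_close r y x"
  by (simp add: unif_close_def abs_minus_commute)

lemma unif_close_trans: "unif_close r x y \<Longrightarrow> unif_close s y z \<Longrightarrow> unif_close (r + s) x z"
  unfolding unif_close_def by (smt (verit))

lemma unif_close_mono: "unif_close r x y \<Longrightarrow> r \<le> s \<Longrightarrow> unif_close s x y"
  unfolding unif_close_def by force

text \<open>Uniformly close paths are Skorokhod-close through the identity time change. The
  exponential is not uniformly continuous on the line, but a path within 1 of x stays in the compact
  range [-B-1, B+1], where it is.\<close>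

lemma skorokhod_continuous_exp:
  assumes f: "skorokhod_continuous f"
  shows "unif_continuous_D (\<lambda>x. f (\<lambda>t. exp (x t)))"
  unfolding unif_continuous_D_def
proof (intro ballI allI impI)
  fix x and e :: real assume x: "x \<in> D01" and e: "0 < e"
  have exp_D: "(\<lambda>t. exp (y t)) \<in> D01" if "y \<in> D01" for y
    using D01_compose_continuous[OF that, of exp] by (simp add: continuous_on_exp)
  obtain d where d: "d > 0" "\<And>y. y \<in> D01 \<Longrightarrow> skorokhod_dist (\<lambda>t. exp (x t)) y < d \<Longrightarrow> \<bar>f y - f (\<lambda>t. exp (x t))\<bar> < e"
    using f exp_D[OF x] e unfolding skorokhod_continuous_def by blast
  obtain B where B: "B > 0" "\<And>t. t \<in> {0..1} \<Longrightarrow> \<bar>x t\<bar> \<le> B" using cadlag_bounded[OF x] by blast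
  have "uniformly_continuous_on {-B-1..B+1} (exp :: real \<Rightarrow> real)"
    by (intro compact_uniformly_continuous continuous_on_exp continuous_on_id) simp
  then obtain r where r: "r > 0" "\<And>a b. a \<in> {-B-1..B+1} \<Longrightarrow> b \<in> {-B-1..B+1} \<Longrightarrow> dist a b < r \<Longrightarrow> dist (exp a) (exp b) < d / 2"
    using d(1) unfolding uniformly_continuous_on_def by (metis half_gt_zero dist_commute)
  show "\<exists>d>0. \<forall>y\<in>D01. unif_close d x y \<longrightarrow> \<bar>f (\<lambda>t. exp (y t)) - f (\<lambda>t. exp (x t))\<bar> < e"
  proof (intro exI[of _ "min 1 (r/2)"] conjI ballI impI)
    fix y assume y: "y \<in> D01" "unif_close (min 1 (r/2)) x y"
    have "skorokhod_dist (\<lambda>t. exp (x t)) (\<lambda>t. exp (y t)) \<le> d / 2"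
    proof (rule skorokhod_dist_le)
      fix t :: real assume t: "t \<in> {0..1}"
      then have "\<bar>x t - y t\<bar> \<le> min 1 (r/2)" using y(2) by (auto simp: unif_close_def)
      then have "\<bar>x t - y t\<bar> \<le> 1" "\<bar>x t - y t\<bar> < r" using r(1) by auto
      with B(2)[OF t] r(2)[of "x t" "y t"] show "\<bar>exp (x t) - exp (y t)\<bar> \<le> d / 2"
        unfolding dist_real_def by (auto simp: abs_le_iff)
    qed (use d in auto)
    then show "\<bar>f (\<lambda>t. exp (y t)) - f (\<lambda>t. exp (x t))\<bar> < e"
      using d exp_D[OF y(1)] by auto
  qed (use r in auto)
qed

section \<open>Lipschitz envelopes of a bounded functional\<close>

context
  fixes g :: "(real \<Rightarrow> real) \<Rightarrow> real" and B :: real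
  assumes g_bounded: "\<And>x. x \<in> D01 \<Longrightarrow> \<bar>g x\<bar> \<le> B"
begin

lemma lip_envelope_set_bdd_below:
  "0 \<le> k \<Longrightarrow> bdd_below {g y + k * r | y r. y \<in> D01 \<and> 0 \<le> r \<and> unif_close r x y}"
  by (rule bdd_belowI[of _ "- B"]) (use g_bounded in \<open>fastforce simp: abs_le_iff intro: add_increasing2\<close>)

lemma lip_envelope_lower:
  "\<lbrakk>0 \<le> k; y \<in> D01; 0 \<le> r; unif_close r x y\<rbrakk> \<Longrightarrow> lip_envelope k g x \<le> g y + k * r"
  unfolding lip_envelope_def by (intro cInf_lower lip_envelope_set_bdd_below) auto

lemma lip_envelope_greatest:
  assumes "x \<in> D01" "\<And>y r. \<lbrakk>y \<in> D01; 0 \<le> r; unif_close r x y\<rbrakk> \<Longrightarrow> c \<le> g y + k * r"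
  shows "c \<le> lip_envelope k g x"
  unfolding lip_envelope_def
proof (rule cInf_greatest)
  have "g x + k * 0 \<in> {g y + k * r | y r. y \<in> D01 \<and> 0 \<le> r \<and> unif_close r x y}"
    using assms(1) unif_close_refl[of 0 x] by blast
  then show "{g y + k * r | y r. y \<in> D01 \<and> 0 \<le> r \<and> unif_close r x y} \<noteq> {}" by blast
qed (use assms(2) in blast)

lemma lip_envelope_le: "0 \<le> k \<Longrightarrow> x \<in> D01 \<Longrightarrow> lip_envelope k g x \<le> g x"
  using lip_envelope_lower[of k x 0 x] by (simp add: unif_close_refl)

lemma lip_envelope_bounded:
  assumes "0 \<le> k" "x \<in> D01" shows "\<bar>lip_envelope k g x\<bar> \<le> B"
proof -
  have "- B \<le> lip_envelope k g x"
    using assms g_bounded by (intro lip_envelope_greatest) (auto simp: abs_le_iff intro!: add_increasing2 dest: minus_le_iff[THEN iffD1])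
  moreover have "lip_envelope k g x \<le> B"
    using lip_envelope_le[OF assms] g_bounded[OF assms(2)] by auto
  ultimately show ?thesis by auto
qed

text \<open>Triangle inequality for an infimal convolution: a competitor at distance r from x'
  competes for x at distance d + r, at extra cost k * d.\<close>

lemma lip_envelope_diff_le:
  assumes "0 \<le> k" "x \<in> D01" "x' \<in> D01" "0 \<le> d" "unif_close d x x'"
  shows "lip_envelope k g x \<le> lip_envelope k g x' + k * d"
proof -
  have "lip_envelope k g x - k * d \<le> lip_envelope k g x'"
  proof (rule lip_envelope_greatest)
    fix y r assume "y \<in> D01" "0 \<le> r" "unif_close r x' y"
    then have "lip_envelope k g x \<le> g y + k * (d + r)"
      using assms by (intro lip_envelope_lower unif_close_trans[OF assms(5)]) auto
    then show "lip_envelope k g x - k * d \<le> g y + k * r" by (simp add: algebra_simps)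
  qed fact
  then show ?thesis by simp
qed

lemma lip_envelope_lipschitz:
  assumes "0 \<le> k" "x \<in> D01" "x' \<in> D01" "0 \<le> d" "unif_close d x x'"
  shows "\<bar>lip_envelope k g x - lip_envelope k g x'\<bar> \<le> k * d"
  using lip_envelope_diff_le[OF assms] lip_envelope_diff_le[OF assms(1,3,2,4) unif_close_sym[OF assms(5)]]
  by auto

lemma lip_envelope_unif_continuous:
  assumes "0 \<le> k" shows "unif_continuous_D (lip_envelope k g)"
  unfolding unif_continuous_D_def
proof (intro ballI allI impI)
  fix x and e :: real assume x: "x \<in> D01" and e: "0 < e"
  show "\<exists>d>0. \<forall>y\<in>D01. unif_close d x y \<longrightarrow> \<bar>lip_envelope k g y - lip_envelope k g x\<bar> < e"
  proof (intro exI[of _ "e / (k + 1)"] conjI ballI impI)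
    fix y assume y: "y \<in> D01" "unif_close (e / (k + 1)) x y"
    have "\<bar>lip_envelope k g y - lip_envelope k g x\<bar> \<le> k * (e / (k + 1))"
      using assms e y x by (intro lip_envelope_lipschitz) (auto intro: unif_close_sym)
    also have "\<dots> < e" using assms e by (simp add: field_simps)
    finally show "\<bar>lip_envelope k g y - lip_envelope k g x\<bar> < e" .
  qed (use assms e in auto)
qed

text \<open>Competitors within d of x have almost the value g x by continuity; farther ones pay a
  penalty of at least k * d, which eventually exceeds 2B, the most that g can gain.\<close>

lemma lip_envelope_tendsto:
  assumes g: "unif_continuous_D g" and x: "x \<in> D01"
  shows "(\<lambda>k. lip_envelope (real k) g x) \<longlonglongrightarrow> g x"
proof (rule LIMSEQ_I)
  fix e :: real assume e: "0 < e"
  obtain d where d: "d > 0" "\<And>y. y \<in> D01 \<Longrightarrow> unif_close d x y \<Longrightarrow> \<bar>g y - g x\<bar> < e / 2"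
    using g x e unfolding unif_continuous_D_def by (meson half_gt_zero)
  obtain K :: nat where K: "real K > 2 * B / d" using reals_Archimedean2 by blast
  have "norm (lip_envelope (real k) g x - g x) < e" if "k \<ge> K" for k
  proof -
    have "g x - e / 2 \<le> lip_envelope (real k) g x"
    proof (rule lip_envelope_greatest[OF x])
      fix y r assume y: "y \<in> D01" "0 \<le> r" "unif_close r x y"
      show "g x - e / 2 \<le> g y + real k * r"
      proof (cases "r \<le> d")
        case True
        then have "\<bar>g y - g x\<bar> < e / 2" using d(2)[OF y(1)] unif_close_mono[OF y(3)] by auto
        moreover have "0 \<le> real k * r" using y by simp
        ultimately show ?thesis by linarith
      next
        case False
        have "2 * B \<le> real K * d" using K d by (simp add: field_simps)
        also have "\<dots> \<le> real k * r" using that False d by (intro mult_mono) auto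
        finally show ?thesis using g_bounded[OF x] g_bounded[OF y(1)] e by linarith
      qed
    qed
    moreover have "lip_envelope (real k) g x \<le> g x" using lip_envelope_le[OF _ x] by simp
    ultimately show ?thesis using e by simp
  qed
  then show "\<exists>no. \<forall>n\<ge>no. norm (lip_envelope (real n) g x - g x) < e" by blast
qed

end

section \<open>The truncated integral as a map from the Skorokhod to the uniform topology\<close>

definition cutoff_integral :: "real \<Rightarrow> (real \<Rightarrow> real) \<Rightarrow> real \<Rightarrow> real" where
  "cutoff_integral \<epsilon> x t = (LINT s:{0..t}|lborel. x s * (if \<epsilon> \<le> s then 1 / s else 0))"

lemma set_integral_continuous_on:
  fixes h :: "real \<Rightarrow> real"
  assumes h: "set_integrable lborel {a..b} h"
  shows "continuous_on {a..b} (\<lambda>t. LINT s:{a..t}|lborel. h s)"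
proof -
  have "h integrable_on {a..b}" using h by (rule set_borel_integral_eq_integral)
  then have "continuous_on {a..b} (\<lambda>t. integral {a..t} h)" by (rule indefinite_integral_continuous_1)
  also have "?this \<longleftrightarrow> ?thesis"
  proof (rule continuous_on_cong)
    fix t assume "t \<in> {a..b}"
    then have "set_integrable lborel {a..t} h" by (intro set_integrable_subset[OF h]) auto
    then show "integral {a..t} h = (LINT s:{a..t}|lborel. h s)" 
      by (simp add: set_borel_integral_eq_integral)
  qed simp
  finally show ?thesis .
qed

lemma cadlag_set_integrable:
  assumes x: "x \<in> D01" and w: "w \<in> borel_measurable borel" "\<And>s. \<bar>w s\<bar> \<le> K" and t: "{a..b} \<subseteq> {0..1}"
  shows "set_integrable lborel {a..b} (\<lambda>s. x s * w s)"
proof -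
  obtain B where B: "B > 0" "\<And>t. t \<in> {0..1} \<Longrightarrow> \<bar>x t\<bar> \<le> B" using cadlag_bounded[OF x] by blast
  have [measurable]: "(\<lambda>t. indicator {0..1} t * x t) \<in> borel_measurable borel" by (rule cadlag_measurable[OF x])
  have [measurable]: "w \<in> borel_measurable borel" by fact
  have "set_integrable lborel {0..1} (\<lambda>s. x s * w s)"
    unfolding set_integrable_def
  proof (rule Bochner_Integration.integrable_bound)
    show "integrable lborel (\<lambda>s::real. indicator {0..1} s * (B * K))"
      by (intro integrable_mult_left integrable_real_indicator) auto
    have "(\<lambda>s. (indicator {0..1} s * x s) * w s) \<in> borel_measurable lborel" by measurable
    then show "(\<lambda>s. indicator {0..1} s *\<^sub>R (x s * w s)) \<in> borel_measurable lborel" by (simp add: mult.assoc)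
    show "AE s in lborel. norm (indicator {0..1} s *\<^sub>R (x s * w s)) \<le> norm (indicator {0..1} s * (B * K))"
    proof (intro AE_I2)
      fix s :: real
      have "0 \<le> K" using w(2)[of 0] by linarith
      then show "norm (indicator {0..1} s *\<^sub>R (x s * w s)) \<le> norm (indicator {0..1} s * (B * K))"
        using B(1) B(2)[of s] w(2)[of s] by (auto simp: indicator_def abs_mult intro!: mult_mono)
    qed
  qed
  then show ?thesis by (rule set_integrable_subset) (use t in auto)
qed

lemma cutoff_weight_bounded: "0 < \<epsilon> \<Longrightarrow> \<bar>if \<epsilon> \<le> s then 1 / s else 0\<bar> \<le> 1 / \<epsilon>" for s :: real
  by (auto simp: field_simps)

lemma cutoff_weight_measurable: "(\<lambda>s::real. if \<epsilon> \<le> s then 1 / s else 0) \<in> borel_measurable borel"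
  by measurable

lemmas cutoff_set_integrable = cadlag_set_integrable[OF _ cutoff_weight_measurable cutoff_weight_bounded]

lemma cutoff_integral_continuous:
  assumes "x \<in> D01" "0 < \<epsilon>" shows "continuous_on {0..1} (cutoff_integral \<epsilon> x)"
  unfolding cutoff_integral_def using assms
  by (intro set_integral_continuous_on cutoff_set_integrable) auto

lemma cutoff_integral_in_D01: "x \<in> D01 \<Longrightarrow> 0 < \<epsilon> \<Longrightarrow> cutoff_integral \<epsilon> x \<in> D01"
  by (rule continuous_imp_D01[OF cutoff_integral_continuous])

text \<open>Skorokhod convergence forces pointwise convergence at every continuity point of x, hence
  almost everywhere, and dominated convergence applies. A sequence refuting the claim is thereby
  excluded.\<close>

lemma skorokhod_L1_continuous:
  assumes x: "x \<in> D01" and e: "0 < e"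
  shows "\<exists>d>0. \<forall>y\<in>D01. skorokhod_dist x y < d \<longrightarrow> (LINT s:{0..1}|lborel. \<bar>y s - x s\<bar>) < e"
proof (rule ccontr)
  assume "\<not> ?thesis"
  then have "\<exists>y\<in>D01. skorokhod_dist x y < d \<and> \<not> (LINT s:{0..1}|lborel. \<bar>y s - x s\<bar>) < e" if "d > 0" for d
    using that by blast
  then have "\<exists>y\<in>D01. skorokhod_dist x y < 1 / Suc m \<and> \<not> (LINT s:{0..1}|lborel. \<bar>y s - x s\<bar>) < e" for m :: nat
    by simp
  then obtain y where y: "\<And>m. y m \<in> D01" "\<And>m::nat. skorokhod_dist x (y m) < 1 / Suc m"
    "\<And>m. \<not> (LINT s:{0..1}|lborel. \<bar>y m s - x s\<bar>) < e" by metis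
  obtain B where B: "B > 0" "\<And>t. t \<in> {0..1} \<Longrightarrow> \<bar>x t\<bar> \<le> B" using cadlag_bounded[OF x] by blast
  have close: "\<exists>t\<in>{0..1}. \<bar>t - s\<bar> < 1 / Suc m \<and> \<bar>x t - y m s\<bar> < 1 / Suc m" if "s \<in> {0..1}" for s m
    by (rule skorokhod_dist_lessD[OF x y(1) y(2) that])
  have [measurable]: "(\<lambda>t. indicator {0..1} t * x t) \<in> borel_measurable borel" by (rule cadlag_measurable[OF x])
  have [measurable]: "(\<lambda>t. indicator {0..1} t * y m t) \<in> borel_measurable borel" for m by (rule cadlag_measurable[OF y(1)])
  have "(\<lambda>m. LINT s|lborel. indicator {0..1} s * \<bar>y m s - x s\<bar>) \<longlonglongrightarrow> integral\<^sup>L lborel (\<lambda>s::real. 0 :: real)"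
  proof (rule integral_dominated_convergence[where w = "\<lambda>s::real. indicator {0..1} s * (2 * B + 1)"])
    fix m
    have "(\<lambda>s. \<bar>indicator {0..1} s * y m s - indicator {0..1} s * x s\<bar>) \<in> borel_measurable lborel" by measurable
    also have "(\<lambda>s. \<bar>indicator {0..1} s * y m s - indicator {0..1} s * x s\<bar>) = (\<lambda>s. indicator {0..1} s * \<bar>y m s - x s\<bar>)"
      by (auto simp: fun_eq_iff indicator_def)
    finally show "(\<lambda>s. indicator {0..1} s * \<bar>y m s - x s\<bar>) \<in> borel_measurable lborel" .
    show "AE s in lborel. norm (indicator {0..1} s * \<bar>y m s - x s\<bar>) \<le> indicator {0..1} s * (2 * B + 1)"
    proof (intro AE_I2)
      fix s :: real
      show "norm (indicator {0..1} s * \<bar>y m s - x s\<bar>) \<le> indicator {0..1} s * (2 * B + 1)"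
      proof (cases "s \<in> {0..1}")
        case True
        then obtain t where t: "t \<in> {0..1}" "\<bar>x t - y m s\<bar> < 1 / Suc m" using close by blast
        have "1 / real (Suc m) \<le> 1" by simp
        \<comment> \<open>Each value of y m lies within 1/(m+1), so within 1, of some value of x,
          which gives a bound independent of m.\<close>
        with t B(2)[OF t(1)] B(2)[OF True] have "\<bar>y m s - x s\<bar> \<le> 2 * B + 1" by linarith
        with True show ?thesis by simp
      qed auto
    qed
  next
    show "AE s in lborel. (\<lambda>m. indicator {0..1} s * \<bar>y m s - x s\<bar>) \<longlonglongrightarrow> 0"
      using cadlag_AE_isCont[OF x]
    proof eventually_elim
      case (elim s)
      show ?case
      proof (cases "s \<in> {0..1}")
        case True
        then have c: "isCont x s" using elim by simp
        \<comment> \<open>The point t m is matched with s by the time change; it tends to s, so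
          continuity of x at s transfers to y m s.\<close>
        obtain t where t: "\<And>m. t m \<in> {0..1}" "\<And>m. \<bar>t m - s\<bar> < 1 / Suc m" "\<And>m. \<bar>x (t m) - y m s\<bar> < 1 / Suc m"
          using close[OF True] by metis
        have z: "(\<lambda>m. 1 / real (Suc m)) \<longlonglongrightarrow> 0" by (rule LIMSEQ_Suc[OF lim_1_over_n])
        have "(\<lambda>m. t m - s) \<longlonglongrightarrow> 0"
          by (rule Lim_null_comparison[OF _ z]) (use t(2) in \<open>auto intro!: always_eventually less_imp_le\<close>)
        then have "t \<longlonglongrightarrow> s" by (simp add: LIM_zero_iff)
        then have "(\<lambda>m. x (t m)) \<longlonglongrightarrow> x s" by (rule isCont_tendsto_compose[OF c])
        moreover have "(\<lambda>m. x (t m) - y m s) \<longlonglongrightarrow> 0"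
          by (rule Lim_null_comparison[OF _ z]) (use t(3) in \<open>auto intro!: always_eventually less_imp_le\<close>)
        ultimately have "(\<lambda>m. x (t m) - (x (t m) - y m s)) \<longlonglongrightarrow> x s - 0" by (rule tendsto_diff)
        then have "(\<lambda>m. \<bar>y m s - x s\<bar>) \<longlonglongrightarrow> \<bar>x s - x s\<bar>" by (intro tendsto_intros) simp
        with True show ?thesis by simp
      qed simp
    qed
  qed (auto)
  then have "(\<lambda>m. LINT s:{0..1}|lborel. \<bar>y m s - x s\<bar>) \<longlonglongrightarrow> 0"
    by (simp add: set_lebesgue_integral_def)
  then have "eventually (\<lambda>m. (LINT s:{0..1}|lborel. \<bar>y m s - x s\<bar>) < e) sequentially"
    using e by (rule order_tendstoD)
  then show False using y(3) by (auto simp: eventually_sequentially)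
qed

text \<open>The weight is at most 1/\<epsilon>, so the difference of the integrals is at most
  1/\<epsilon> times the \<open>L^1\<close> distance of the paths, simultaneously for all t; hence
  the tolerance e * \<epsilon>.\<close>

lemma cutoff_integral_skorokhod_continuous:
  assumes x: "x \<in> D01" and \<epsilon>: "0 < \<epsilon>" and e: "0 < e"
  shows "\<exists>d>0. \<forall>y\<in>D01. skorokhod_dist x y < d \<longrightarrow> unif_close e (cutoff_integral \<epsilon> x) (cutoff_integral \<epsilon> y)"
proof -
  from skorokhod_L1_continuous[OF x, of "e * \<epsilon>"] obtain d where d: "d > 0"
    "\<And>y. y \<in> D01 \<Longrightarrow> skorokhod_dist x y < d \<Longrightarrow> (LINT s:{0..1}|lborel. \<bar>y s - x s\<bar>) < e * \<epsilon>"
    using \<epsilon> e by auto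
  show ?thesis
  proof (intro exI[of _ d] conjI ballI impI, fact, unfold unif_close_def, intro ballI)
    fix y t assume y: "y \<in> D01" "skorokhod_dist x y < d" and t: "t \<in> {0..1::real}"
    let ?w = "\<lambda>s::real. if \<epsilon> \<le> s then 1 / s else 0"
    have ix: "set_integrable lborel {0..t} (\<lambda>s. x s * ?w s)" "set_integrable lborel {0..t} (\<lambda>s. y s * ?w s)"
      using x y t \<epsilon> by (auto intro!: cutoff_set_integrable)
    have "set_integrable lborel {0..1} (\<lambda>s. y s * 1)" "set_integrable lborel {0..1} (\<lambda>s. x s * 1)"
      using cadlag_set_integrable[OF y(1), of "\<lambda>_. 1" 1 0 1] cadlag_set_integrable[OF x, of "\<lambda>_. 1" 1 0 1] by simp_all
    then have i1: "set_integrable lborel {0..1} (\<lambda>s. \<bar>y s - x s\<bar>)"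
      by (intro set_integrable_abs set_integral_diff) auto
    have "\<bar>cutoff_integral \<epsilon> x t - cutoff_integral \<epsilon> y t\<bar> = \<bar>LINT s:{0..t}|lborel. x s * ?w s - y s * ?w s\<bar>"
      unfolding cutoff_integral_def using ix by (simp add: set_integral_diff)
    also have "\<dots> \<le> (LINT s:{0..t}|lborel. \<bar>x s * ?w s - y s * ?w s\<bar>)"
      using set_integral_norm_bound[OF set_integral_diff(1)[OF ix]] by simp
    also have "\<dots> \<le> (LINT s:{0..1}|lborel. 1 / \<epsilon> * \<bar>y s - x s\<bar>)"
      unfolding set_lebesgue_integral_def
    proof (rule integral_mono)
      show "integrable lborel (\<lambda>s. indicator {0..t} s *\<^sub>R \<bar>x s * ?w s - y s * ?w s\<bar>)"
        by (rule set_integrable_abs[OF set_integral_diff(1)[OF ix], unfolded set_integrable_def])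
      show "integrable lborel (\<lambda>s. indicator {0..1} s *\<^sub>R (1 / \<epsilon> * \<bar>y s - x s\<bar>))"
        by (rule set_integrable_mult_right[OF i1, of "1 / \<epsilon>", unfolded set_integrable_def])
      fix s :: real
      have "\<bar>x s * ?w s - y s * ?w s\<bar> = \<bar>?w s\<bar> * \<bar>y s - x s\<bar>"
        by (simp only: left_diff_distrib[symmetric] abs_mult abs_minus_commute[of "x s"] mult.commute)
      also have "\<dots> \<le> 1 / \<epsilon> * \<bar>y s - x s\<bar>"
        using cutoff_weight_bounded[OF \<epsilon>] by (intro mult_right_mono) auto
      finally show "indicator {0..t} s *\<^sub>R \<bar>x s * ?w s - y s * ?w s\<bar> \<le> indicator {0..1} s *\<^sub>R (1 / \<epsilon> * \<bar>y s - x s\<bar>)"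
        using t \<epsilon> by (cases "s \<in> {0..t}") (simp_all del: split_paired_All if_split)
    qed
    also have "\<dots> = 1 / \<epsilon> * (LINT s:{0..1}|lborel. \<bar>y s - x s\<bar>)" by simp
    also have "\<dots> \<le> e" using d(2)[OF y] \<epsilon> by (simp add: field_simps)
    finally show "\<bar>cutoff_integral \<epsilon> x t - cutoff_integral \<epsilon> y t\<bar> \<le> e" .
  qed
qed

text \<open>This makes a uniform-norm functional of the truncated integral an admissible test
  functional in the hypothesis on the partial sums.\<close>

lemma skorokhod_continuous_cutoff:
  assumes g: "unif_continuous_D g" and \<epsilon>: "0 < \<epsilon>"
  shows "skorokhod_continuous (\<lambda>x. g (cutoff_integral \<epsilon> x))"
  unfolding skorokhod_continuous_def
proof (intro ballI allI impI)
  fix x and e :: real assume x: "x \<in> D01" and e: "0 < e"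
  obtain r where r: "r > 0" "\<And>y. y \<in> D01 \<Longrightarrow> unif_close r (cutoff_integral \<epsilon> x) y \<Longrightarrow> \<bar>g y - g (cutoff_integral \<epsilon> x)\<bar> < e"
    using g cutoff_integral_in_D01[OF x \<epsilon>] e unfolding unif_continuous_D_def by meson
  from cutoff_integral_skorokhod_continuous[OF x \<epsilon> r(1)] r(2) cutoff_integral_in_D01[OF _ \<epsilon>]
  show "\<exists>d>0. \<forall>y\<in>D01. skorokhod_dist x y < d \<longrightarrow> \<bar>g (cutoff_integral \<epsilon> y) - g (cutoff_integral \<epsilon> x)\<bar> < e"
    by meson
qed

section \<open>Measurability of path functionals\<close>

text \<open>Integer lists form a countable discrete space, from which every function is measurable.
  An arbitrary path functional thus becomes measurable once the path is coded by such a
  list.\<close>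

lemma int_list_measurable:
  fixes z :: "nat \<Rightarrow> 'a \<Rightarrow> int"
  assumes "\<And>j. j < n \<Longrightarrow> z j \<in> measurable M (count_space UNIV)"
  shows "(\<lambda>\<omega>. map (\<lambda>j. z j \<omega>) [0..<n]) \<in> measurable M (count_space UNIV)"
proof (rule measurable_count_space_eq2_countable[THEN iffD2], rule conjI[OF _ ballI])
  fix c :: "int list"
  have meas: "{\<omega>\<in>space M. z j \<omega> = c ! j} \<in> sets M" if "j \<in> {..<n}" for j
    using measurable_sets_Collect[OF assms[of j], of "\<lambda>i. i = c ! j"] that by simp
  have "map (\<lambda>j. z j \<omega>) [0..<n] = c \<longleftrightarrow> n = length c \<and> (\<forall>j<n. z j \<omega> = c ! j)" for \<omega>
    by (simp add: list_eq_iff_nth_eq)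
  then have eq: "(\<lambda>\<omega>. map (\<lambda>j. z j \<omega>) [0..<n]) -` {c} \<inter> space M =
    (if n = length c then {\<omega>\<in>space M. \<forall>j\<in>{..<n}. z j \<omega> = c ! j} else {})"
    by auto
  show "(\<lambda>\<omega>. map (\<lambda>j. z j \<omega>) [0..<n]) -` {c} \<inter> space M \<in> sets M"
  proof -
    have "{\<omega>\<in>space M. \<forall>j\<in>{..<n}. z j \<omega> = c ! j} \<in> sets M"
      by (rule sets.sets_Collect_finite_All[OF meas]) auto
    then show ?thesis unfolding eq by auto
  qed
qed simp

text \<open>No measurability of \<open>g\<close> itself is available: the path is approximated by
  step functions that take only countably many values.\<close>
lemma functional_measurable:
  fixes X :: "'a \<Rightarrow> real \<Rightarrow> real" and p :: "nat \<Rightarrow> nat"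
  assumes g: "unif_continuous_D g"
    and X_D: "\<And>\<omega>. \<omega> \<in> space M \<Longrightarrow> X \<omega> \<in> D01"
    and X_meas: "\<And>t. t \<in> {0..1} \<Longrightarrow> (\<lambda>\<omega>. X \<omega> t) \<in> borel_measurable M"
    and grid: "\<And>\<omega> e. \<omega> \<in> space M \<Longrightarrow> 0 < e \<Longrightarrow> eventually (\<lambda>m. unif_close e (X \<omega>) (\<lambda>t. X \<omega> (real (nat \<lfloor>real (p m) * t\<rfloor>) / real (p m)))) sequentially"
  shows "(\<lambda>\<omega>. g (X \<omega>)) \<in> borel_measurable M"
proof -
  \<comment> \<open>Path values at the grid points j / p m, rounded down to multiples of 1/(m+1).
    The list has p m + 1 entries because t = 1 has index p m. The grid size p is left open: it is
    constant for step paths and grows for continuous ones.\<close>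
  define Z where "Z m \<omega> = map (\<lambda>j. \<lfloor>real (Suc m) * X \<omega> (real j / real (p m))\<rfloor>) [0..<Suc (p m)]" for m \<omega>
  define step where "step m c = (\<lambda>t. real_of_int (c ! nat \<lfloor>real (p m) * t\<rfloor>) / real (Suc m))" for m and c :: "int list"
  have Z_meas: "Z m \<in> measurable M (count_space UNIV)" for m
    unfolding Z_def
  proof (rule int_list_measurable)
    fix j assume "j < Suc (p m)"
    then have [measurable]: "(\<lambda>\<omega>. X \<omega> (real j / real (p m))) \<in> borel_measurable M"
      by (intro X_meas) (auto simp: divide_le_eq)
    show "(\<lambda>\<omega>. \<lfloor>real (Suc m) * X \<omega> (real j / real (p m))\<rfloor>) \<in> measurable M (count_space UNIV)"
      by measurable
  qed
  have step_D: "step m c \<in> D01" for m c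
    unfolding step_def by (rule grid_step_in_D01)
  have step_close: "unif_close (1 / Suc m) (\<lambda>t. X \<omega> (real (nat \<lfloor>real (p m) * t\<rfloor>) / real (p m))) (step m (Z m \<omega>))" for m \<omega>
    unfolding unif_close_def
  proof
    fix t :: real assume t: "t \<in> {0..1}"
    define j where "j = nat \<lfloor>real (p m) * t\<rfloor>"
    have "real (p m) * t \<le> real (p m)" using t by (simp add: mult_left_le)
    then have "j < Suc (p m)" unfolding j_def using t by (simp add: nat_le_iff floor_le_iff less_Suc_eq_le)
    then have "step m (Z m \<omega>) t = real_of_int \<lfloor>real (Suc m) * X \<omega> (real j / real (p m))\<rfloor> / real (Suc m)"
      unfolding step_def Z_def j_def[symmetric] by (simp del: upt_Suc)
    moreover have "\<bar>a - real_of_int \<lfloor>real (Suc m) * a\<rfloor> / real (Suc m)\<bar> \<le> 1 / real (Suc m)" for a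
    proof -
      have "a - real_of_int \<lfloor>real (Suc m) * a\<rfloor> / real (Suc m) = (real (Suc m) * a - real_of_int \<lfloor>real (Suc m) * a\<rfloor>) / real (Suc m)"
        by (simp add: diff_divide_distrib)
      moreover have "\<bar>real (Suc m) * a - real_of_int \<lfloor>real (Suc m) * a\<rfloor>\<bar> \<le> 1" by linarith
      ultimately show ?thesis by (simp add: divide_right_mono)
    qed
    ultimately show "\<bar>X \<omega> (real (nat \<lfloor>real (p m) * t\<rfloor>) / real (p m)) - step m (Z m \<omega>) t\<bar> \<le> 1 / real (Suc m)"
      unfolding j_def[symmetric] by metis
  qed
  show ?thesis
  proof (rule borel_measurable_LIMSEQ_real)
    show "(\<lambda>\<omega>. g (step m (Z m \<omega>))) \<in> borel_measurable M" for m
      by (rule measurable_compose[OF Z_meas]) simp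
    fix \<omega> assume \<omega>: "\<omega> \<in> space M"
    show "(\<lambda>m. g (step m (Z m \<omega>))) \<longlonglongrightarrow> g (X \<omega>)"
    proof (rule tendstoI)
      fix e :: real assume "0 < e"
      then obtain d where d: "d > 0" "\<And>y. y \<in> D01 \<Longrightarrow> unif_close d (X \<omega>) y \<Longrightarrow> \<bar>g y - g (X \<omega>)\<bar> < e"
        using g X_D[OF \<omega>] unfolding unif_continuous_D_def by meson
      have "eventually (\<lambda>m. 1 / real (Suc m) < d / 2) sequentially"
        using d by (intro order_tendstoD(2)[OF LIMSEQ_Suc[OF lim_1_over_n]]) auto
      moreover have "eventually (\<lambda>m. unif_close (d / 2) (X \<omega>) (\<lambda>t. X \<omega> (real (nat \<lfloor>real (p m) * t\<rfloor>) / real (p m)))) sequentially"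
        using d by (intro grid \<omega>) auto
      ultimately show "eventually (\<lambda>m. dist (g (step m (Z m \<omega>))) (g (X \<omega>)) < e) sequentially"
      proof eventually_elim
        case (elim m)
        have "unif_close (d / 2 + 1 / Suc m) (X \<omega>) (step m (Z m \<omega>))"
          by (rule unif_close_trans[OF elim(2) step_close])
        then have "unif_close d (X \<omega>) (step m (Z m \<omega>))" 
          by (rule unif_close_mono) (use elim(1) in simp)
        then show ?case using d(2)[OF step_D] by (simp add: dist_real_def)
      qed
    qed
  qed
qed

text \<open>Sampling a step path on its own grid reproduces it exactly, so the grid stays fixed and
  only the rounding of values is refined. For n = 0 every index is 0 and the identity
  persists.\<close>

lemma grid_step_functional_measurable:
  fixes z :: "nat \<Rightarrow> 'a \<Rightarrow> real"
  assumes g: "unif_continuous_D g" and z: "\<And>k. z k \<in> borel_measurable M"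
  shows "(\<lambda>\<omega>. g (\<lambda>t. z (nat \<lfloor>real n * t\<rfloor>) \<omega>)) \<in> borel_measurable M"
proof (rule functional_measurable[OF g, where p = "\<lambda>_. n"])
  fix \<omega> and e :: real assume "0 < e"
  have "nat \<lfloor>real n * (real (nat \<lfloor>real n * t\<rfloor>) / real n)\<rfloor> = nat \<lfloor>real n * t\<rfloor>" for t
    by (cases "n = 0") auto
  with \<open>0 < e\<close> show "eventually (\<lambda>m. unif_close e (\<lambda>t. z (nat \<lfloor>real n * t\<rfloor>) \<omega>) (\<lambda>t. z (nat \<lfloor>real n * (real (nat \<lfloor>real n * t\<rfloor>) / real n)\<rfloor>) \<omega>)) sequentially"
    by (simp add: unif_close_refl)
qed (use z grid_step_in_D01 in auto)

lemma grid_point_close: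
  assumes "0 \<le> t" shows "\<bar>t - real (nat \<lfloor>real (Suc m) * t\<rfloor>) / real (Suc m)\<bar> \<le> 1 / real (Suc m)"
proof -
  have "t - real (nat \<lfloor>real (Suc m) * t\<rfloor>) / real (Suc m) = (real (Suc m) * t - real (nat \<lfloor>real (Suc m) * t\<rfloor>)) / real (Suc m)"
    by (simp add: diff_divide_distrib)
  moreover have "0 \<le> real (Suc m) * t" using assms by simp
  then have "\<bar>real (Suc m) * t - real (nat \<lfloor>real (Suc m) * t\<rfloor>)\<bar> \<le> 1" by linarith
  ultimately show ?thesis by (simp add: divide_right_mono)
qed

text \<open>Uniform continuity on the compact interval makes sampling on the grid of mesh 1/(m+1)
  uniformly accurate.\<close>

lemma continuous_functional_measurable:
  fixes X :: "'a \<Rightarrow> real \<Rightarrow> real"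
  assumes g: "unif_continuous_D g"
    and X_cont: "\<And>\<omega>. \<omega> \<in> space M \<Longrightarrow> continuous_on {0..1} (X \<omega>)"
    and X_meas: "\<And>t. t \<in> {0..1} \<Longrightarrow> (\<lambda>\<omega>. X \<omega> t) \<in> borel_measurable M"
  shows "(\<lambda>\<omega>. g (X \<omega>)) \<in> borel_measurable M"
proof (rule functional_measurable[OF g _ X_meas, where p = Suc])
  fix \<omega> and e :: real assume \<omega>: "\<omega> \<in> space M" and e: "0 < e"
  have "uniformly_continuous_on {0..1} (X \<omega>)"
    by (intro compact_uniformly_continuous X_cont \<omega>) simp
  then obtain d where d: "d > 0" "\<And>s t. s \<in> {0..1} \<Longrightarrow> t \<in> {0..1} \<Longrightarrow> dist s t < d \<Longrightarrow> dist (X \<omega> s) (X \<omega> t) < e"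
    using e unfolding uniformly_continuous_on_def by metis
  have "eventually (\<lambda>m. 1 / real (Suc m) < d) sequentially"
    using d by (intro order_tendstoD(2)[OF LIMSEQ_Suc[OF lim_1_over_n]]) auto
  then show "eventually (\<lambda>m. unif_close e (X \<omega>) (\<lambda>t. X \<omega> (real (nat \<lfloor>real (Suc m) * t\<rfloor>) / real (Suc m)))) sequentially"
  proof eventually_elim
    case (elim m)
    show ?case unfolding unif_close_def
    proof
      fix t :: real assume t: "t \<in> {0..1}"
      have "real (Suc m) * t \<le> real (Suc m)" "0 \<le> real (Suc m) * t" using t by (simp_all add: mult_left_le)
      then have "real (nat \<lfloor>real (Suc m) * t\<rfloor>) \<le> real (Suc m)" by linarith
      then have "real (nat \<lfloor>real (Suc m) * t\<rfloor>) / real (Suc m) \<in> {0..1}"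
        by (simp add: divide_le_eq del: of_nat_Suc)
      then have "dist (X \<omega> t) (X \<omega> (real (nat \<lfloor>real (Suc m) * t\<rfloor>) / real (Suc m))) < e"
        using grid_point_close[of t m] elim t by (intro d(2)) (auto simp: dist_real_def)
      then show "\<bar>X \<omega> t - X \<omega> (real (nat \<lfloor>real (Suc m) * t\<rfloor>) / real (Suc m))\<bar> \<le> e"
        by (simp add: dist_real_def)
    qed
  qed
qed (use X_cont continuous_imp_D01 in auto)

lemma grid_step_joint_measurable:
  fixes z :: "nat \<Rightarrow> 'a \<Rightarrow> real"
  assumes [measurable]: "\<And>k. z k \<in> borel_measurable M"
  shows "(\<lambda>(\<omega>, s). z (nat \<lfloor>real n * s\<rfloor>) \<omega>) \<in> borel_measurable (M \<Otimes>\<^sub>M lborel)"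
proof -
  have "(\<lambda>x. z (nat \<lfloor>real n * snd x\<rfloor>) (fst x)) \<in> borel_measurable (M \<Otimes>\<^sub>M lborel)"
    by (rule measurable_compose_countable[where f = "\<lambda>k x. z k (fst x)"]) measurable
  then show ?thesis by (simp add: split_beta')
qed

text \<open>The process is the pointwise limit of its values at left grid points, and each
  approximation is jointly measurable because it selects among countably many random variables.
  Clipping the time at 0 keeps negative times out.\<close>

lemma continuous_joint_measurable:
  fixes X :: "'a \<Rightarrow> real \<Rightarrow> real"
  assumes X_meas: "\<And>t. 0 \<le> t \<Longrightarrow> (\<lambda>\<omega>. X \<omega> t) \<in> borel_measurable M"
    and X_cont: "\<And>\<omega>. \<omega> \<in> space M \<Longrightarrow> continuous_on {0..} (X \<omega>)"
  shows "(\<lambda>(\<omega>, s). X \<omega> (max 0 s)) \<in> borel_measurable (M \<Otimes>\<^sub>M lborel)"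
proof (rule borel_measurable_LIMSEQ_real)
  show "(\<lambda>(\<omega>, s). X \<omega> (real (nat \<lfloor>real (Suc m) * s\<rfloor>) / real (Suc m))) \<in> borel_measurable (M \<Otimes>\<^sub>M lborel)" for m
    by (rule grid_step_joint_measurable[of "\<lambda>k \<omega>. X \<omega> (real k / real (Suc m))"]) (simp add: X_meas)
  fix x assume "x \<in> space (M \<Otimes>\<^sub>M (lborel :: real measure))"
  then obtain \<omega> s where x: "x = (\<omega>, s)" "\<omega> \<in> space M" by (cases x) (auto simp: space_pair_measure)
  have "(\<lambda>m. X \<omega> (real (nat \<lfloor>real (Suc m) * s\<rfloor>) / real (Suc m))) \<longlonglongrightarrow> X \<omega> (max 0 s)"
  proof (rule continuous_on_tendsto_compose[OF X_cont[OF x(2)]])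
    have z: "(\<lambda>m. 1 / real (Suc m)) \<longlonglongrightarrow> 0" by (rule LIMSEQ_Suc[OF lim_1_over_n])
    \<comment> \<open>For negative s the conversion \<open>nat\<close> sends the index to 0, just as
      clipping the time does.\<close>
    have eq: "nat \<lfloor>real (Suc m) * s\<rfloor> = nat \<lfloor>real (Suc m) * max 0 s\<rfloor>" for m
    proof (cases "0 \<le> s")
      case False
      then have "real (Suc m) * s < 0" by (simp add: mult_less_0_iff)
      then have "nat \<lfloor>real (Suc m) * s\<rfloor> = 0" by (simp add: floor_le_iff)
      with False show ?thesis by simp
    qed simp
    have "(\<lambda>m. max 0 s - real (nat \<lfloor>real (Suc m) * s\<rfloor>) / real (Suc m)) \<longlonglongrightarrow> 0"
      unfolding eq by (rule Lim_null_comparison[OF _ z]) (unfold real_norm_def, intro always_eventually allI grid_point_close, simp)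
    from tendsto_diff[OF tendsto_const[of "max 0 s"] this]
    show "(\<lambda>m. real (nat \<lfloor>real (Suc m) * s\<rfloor>) / real (Suc m)) \<longlonglongrightarrow> max 0 s" by simp
  qed auto
  then show "(\<lambda>m. case x of (\<omega>, s) \<Rightarrow> X \<omega> (real (nat \<lfloor>real (Suc m) * s\<rfloor>) / real (Suc m))) \<longlonglongrightarrow> (case x of (\<omega>, s) \<Rightarrow> X \<omega> (max 0 s))"
    by (simp add: x)
qed

lemma weighted_integral_measurable:
  fixes X :: "'a \<Rightarrow> real \<Rightarrow> real"
  assumes [measurable]: "(\<lambda>(\<omega>, s). X \<omega> (max 0 s)) \<in> borel_measurable (M \<Otimes>\<^sub>M lborel)" "w \<in> borel_measurable borel"
  shows "(\<lambda>\<omega>. LINT s:{0..t}|lborel. X \<omega> s * w s) \<in> borel_measurable M"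
proof -
  have "(\<lambda>\<omega>. LINT s|lborel. (indicator {0..t} s * (X \<omega> (max 0 s) * w s) :: real)) \<in> borel_measurable M"
    by measurable
  also have "(\<lambda>\<omega>. LINT s|lborel. (indicator {0..t} s * (X \<omega> (max 0 s) * w s) :: real)) = (\<lambda>\<omega>. LINT s:{0..t}|lborel. X \<omega> s * w s)"
    unfolding set_lebesgue_integral_def
    by (intro ext Bochner_Integration.integral_cong) (auto simp: indicator_def)
  finally show ?thesis .
qed

section \<open>The integral of the Wiener process\<close>

lemma div_set_integrable_away_from_0:
  fixes w :: "real \<Rightarrow> real"
  assumes w: "continuous_on {0..1} w" and t: "0 < t"
  shows "set_integrable lborel {t..1} (\<lambda>s. w s / s)"
  by (rule borel_integrable_atLeastAtMost')
     (use t in \<open>auto intro!: continuous_intros continuous_on_subset[OF w]\<close>)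

text \<open>If w s / s is not integrable at 0, its integral over {0..t} is 0 by convention for each
  t > 0, since {t..1} is never the obstruction. Thus the limit path lies in \<open>D01\<close> for
  every outcome, including those in the exceptional null set.\<close>

lemma div_integral_continuous:
  fixes w :: "real \<Rightarrow> real"
  assumes w: "continuous_on {0..1} w"
  shows "continuous_on {0..1} (\<lambda>t. LINT s:{0..t}|lborel. w s / s)"
proof (cases "set_integrable lborel {0..1} (\<lambda>s. w s / s)")
  case True
  then show ?thesis by (rule set_integral_continuous_on)
next
  case False
  have "(LINT s:{0..t}|lborel. w s / s) = 0" if t: "t \<in> {0..1}" for t
  proof (cases "t = 0")
    case True
    have "(LINT s:{0..t}|lborel. w s / s) = (LINT s:{0..t}|lborel. 0)"
      using True by (intro set_lebesgue_integral_cong) auto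
    then show ?thesis by simp
  next
    case pos: False
    have "\<not> set_integrable lborel {0..t} (\<lambda>s. w s / s)"
    proof
      assume "set_integrable lborel {0..t} (\<lambda>s. w s / s)"
      then have "set_integrable lborel ({0..t} \<union> {t..1}) (\<lambda>s. w s / s)"
        using t pos by (intro set_integrable_Un div_set_integrable_away_from_0 w) auto
      moreover have "{0..t} \<union> {t..1} = {0..1}" using t by auto
      ultimately show False using False by simp
    qed
    then show ?thesis
      by (simp add: set_lebesgue_integral_def set_integrable_def not_integrable_integral_eq)
  qed
  then have "continuous_on {0..1} (\<lambda>t. LINT s:{0..t}|lborel. w s / s) \<longleftrightarrow> continuous_on {0..1::real} (\<lambda>t. 0::real)"
    by (intro continuous_on_cong) auto
  then show ?thesis by simp
qed

text \<open>Uniformly in t, the error is at most the integral of |w s / s| over s < 1/(j+1), a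
  shrinking piece of an integrable function.\<close>

lemma cutoff_integral_tendsto:
  fixes w :: "real \<Rightarrow> real"
  assumes w: "continuous_on {0..1} w" and int: "set_integrable lborel {0..1} (\<lambda>s. w s / s)" and e: "0 < e"
  shows "eventually (\<lambda>j. unif_close e (\<lambda>t. LINT s:{0..t}|lborel. w s / s) (cutoff_integral (1 / real (Suc j)) w)) sequentially"
proof -
  define r where "r j s = indicator {0..1} s * (if s < 1 / real (Suc j) then \<bar>w s / s\<bar> else 0)" for j and s :: real
  have int': "integrable lborel (\<lambda>s. indicator {0..1} s * \<bar>w s / s\<bar>)"
    using set_integrable_abs[OF int] by (simp add: set_integrable_def)
  then have m[measurable]: "(\<lambda>s. indicator {0..1} s * \<bar>w s / s\<bar>) \<in> borel_measurable lborel" by auto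
  have r_meas: "r j \<in> borel_measurable lborel" for j
  proof -
    have "(\<lambda>s. if s < 1 / real (Suc j) then indicator {0..1} s * \<bar>w s / s\<bar> else 0) \<in> borel_measurable lborel"
      by measurable
    also have "(\<lambda>s. if s < 1 / real (Suc j) then indicator {0..1} s * \<bar>w s / s\<bar> else 0) = r j"
      by (auto simp: r_def fun_eq_iff)
    finally show ?thesis .
  qed
  have r_int: "integrable lborel (r j)" for j
    by (rule Bochner_Integration.integrable_bound[OF int' r_meas]) (auto simp: r_def indicator_def)
  have "(\<lambda>j. integral\<^sup>L lborel (r j)) \<longlonglongrightarrow> integral\<^sup>L lborel (\<lambda>s::real. 0 :: real)"
  proof (rule integral_dominated_convergence[OF _ r_meas int'])
    show "AE s in lborel. (\<lambda>j. r j s) \<longlonglongrightarrow> 0"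
    proof (rule AE_I2)
      fix s :: real
      show "(\<lambda>j. r j s) \<longlonglongrightarrow> 0"
      proof (cases "0 < s")
        case True
        then have "eventually (\<lambda>j. 1 / real (Suc j) < s) sequentially"
          by (intro order_tendstoD(2)[OF LIMSEQ_Suc[OF lim_1_over_n]]) auto
        then have "eventually (\<lambda>j. r j s = 0) sequentially"
          by eventually_elim (auto simp: r_def)
        then show ?thesis by (rule tendsto_eventually)
      next
        case False
        \<comment> \<open>At s = 0 the quotient is 0, as division by zero yields 0.\<close>
        then have "s = 0 \<or> s \<notin> {0..1}" by auto
        then show ?thesis by (auto simp: r_def)
      qed
    qed
    show "AE s in lborel. norm (r j s) \<le> indicator {0..1} s * \<bar>w s / s\<bar>" for j
      by (rule AE_I2) (auto simp: r_def indicator_def)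
  qed simp
  then have "eventually (\<lambda>j. integral\<^sup>L lborel (r j) < e) sequentially"
    using e by (intro order_tendstoD(2)) auto
  then show ?thesis
  proof eventually_elim
    case (elim j)
    show ?case unfolding unif_close_def cutoff_integral_def
    proof
      fix t :: real assume t: "t \<in> {0..1}"
      let ?c = "\<lambda>s. w s * (if 1 / real (Suc j) \<le> s then 1 / s else 0)"
      have i1: "set_integrable lborel {0..t} (\<lambda>s. w s / s)"
        by (rule set_integrable_subset[OF int]) (use t in auto)
      have i2: "set_integrable lborel {0..t} ?c"
        using t w by (intro cutoff_set_integrable continuous_imp_D01) auto
      have "\<bar>(LINT s:{0..t}|lborel. w s / s) - (LINT s:{0..t}|lborel. ?c s)\<bar> = \<bar>LINT s:{0..t}|lborel. w s / s - ?c s\<bar>"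
        by (simp only: set_integral_diff(2)[OF i1 i2])
      also have "\<dots> \<le> (LINT s:{0..t}|lborel. \<bar>w s / s - ?c s\<bar>)"
        using set_integral_norm_bound[OF set_integral_diff(1)[OF i1 i2]] by simp
      also have "\<dots> \<le> integral\<^sup>L lborel (r j)"
        unfolding set_lebesgue_integral_def
      proof (rule integral_mono[OF _ r_int])
        show "integrable lborel (\<lambda>s. indicator {0..t} s *\<^sub>R \<bar>w s / s - ?c s\<bar>)"
          by (rule set_integrable_abs[OF set_integral_diff(1)[OF i1 i2], unfolded set_integrable_def])
        show "indicator {0..t} s *\<^sub>R \<bar>w s / s - ?c s\<bar> \<le> r j s" for s
          using t by (cases "1 / real (Suc j) \<le> s") (auto simp: r_def indicator_def simp del: of_nat_Suc)
      qed
      finally show "\<bar>(LINT s:{0..t}|lborel. w s / s) - (LINT s:{0..t}|lborel. ?c s)\<bar> \<le> e"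
        using elim by linarith
    qed
  qed
qed

lemma wiener_abs_moment:
  assumes W: "standard_wiener_process N W" and t: "0 < t"
  shows "(\<integral>\<^sup>+\<omega>. ennreal \<bar>W t \<omega>\<bar> \<partial>N) \<le> ennreal (sqrt t)"
proof -
  interpret prob_space N using W by (simp add: standard_wiener_process_def)
  have W0: "\<And>\<omega>. \<omega> \<in> space N \<Longrightarrow> W 0 \<omega> = 0" using W by (simp add: standard_wiener_process_def)
  have "distributed N lborel (\<lambda>\<omega>. W t \<omega> - W 0 \<omega>) (normal_density 0 (sqrt (t - 0)))"
    using W t unfolding standard_wiener_process_def by blast
  then have D: "distributed N lborel (\<lambda>\<omega>. W t \<omega> - W 0 \<omega>) (normal_density 0 (sqrt t))" by simp
  have sq: "(\<integral>\<omega>. (W t \<omega> - W 0 \<omega>)\<^sup>2 \<partial>N) = t" "integrable N (\<lambda>\<omega>. (W t \<omega> - W 0 \<omega>)\<^sup>2)"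
  proof -
    have "(\<integral>\<omega>. (W t \<omega> - W 0 \<omega>)\<^sup>2 \<partial>N) = (\<integral>x. normal_density 0 (sqrt t) x * x\<^sup>2 \<partial>lborel)"
      by (rule distributed_integral[OF D, symmetric]) auto
    also have "\<dots> = t"
      using integral_normal_moment_even[of "sqrt t" 0 1] t by (simp add: fact_numeral)
    finally show "(\<integral>\<omega>. (W t \<omega> - W 0 \<omega>)\<^sup>2 \<partial>N) = t" .
    show "integrable N (\<lambda>\<omega>. (W t \<omega> - W 0 \<omega>)\<^sup>2)"
      using integrable_normal_moment[of "sqrt t" 0 2] t by (subst distributed_integrable[OF D, symmetric]) auto
  qed
  \<comment> \<open>The arithmetic-geometric mean inequality, balanced at \<open>sqrt t\<close>:
    with second moment t both halves contribute \<open>sqrt t / 2\<close>.\<close>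
  have amgm: "\<bar>a\<bar> \<le> a\<^sup>2 / (2 * sqrt t) + sqrt t / 2" for a :: real
  proof -
    have "2 * sqrt t * \<bar>a\<bar> \<le> a\<^sup>2 + t"
      using sum_squares_bound[of "sqrt t" "\<bar>a\<bar>"] t by (simp add: mult.assoc)
    then have "\<bar>a\<bar> \<le> (a\<^sup>2 + sqrt t * sqrt t) / (2 * sqrt t)" using t by (simp add: field_simps)
    also have "\<dots> = a\<^sup>2 / (2 * sqrt t) + sqrt t / 2" using t by (simp add: add_divide_distrib real_div_sqrt)
    finally show ?thesis .
  qed
  have "(\<integral>\<^sup>+\<omega>. ennreal \<bar>W t \<omega>\<bar> \<partial>N) \<le> (\<integral>\<^sup>+\<omega>. ennreal ((W t \<omega> - W 0 \<omega>)\<^sup>2 / (2 * sqrt t) + sqrt t / 2) \<partial>N)"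
    by (intro nn_integral_mono ennreal_leI) (use amgm W0 in simp)
  also have "\<dots> = ennreal (\<integral>\<omega>. (W t \<omega> - W 0 \<omega>)\<^sup>2 / (2 * sqrt t) + sqrt t / 2 \<partial>N)"
    using sq t by (intro nn_integral_eq_integral) auto
  also have "(\<integral>\<omega>. (W t \<omega> - W 0 \<omega>)\<^sup>2 / (2 * sqrt t) + sqrt t / 2 \<partial>N) = t / (2 * sqrt t) + sqrt t / 2"
    using sq by (simp add: prob_space)
  also have "\<dots> = sqrt t" using t by (simp add: real_div_sqrt field_simps)
  finally show ?thesis .
qed

lemma wiener_joint_measurable:
  assumes W: "standard_wiener_process N W"
  shows "(\<lambda>(\<omega>, s). W (max 0 s) \<omega>) \<in> borel_measurable (N \<Otimes>\<^sub>M lborel)"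
proof -
  have "(\<lambda>\<omega>. W t \<omega>) \<in> borel_measurable N" if "0 \<le> t" for t
    using W that unfolding standard_wiener_process_def by blast
  moreover have "continuous_on {0..} (\<lambda>s. W s \<omega>)" if "\<omega> \<in> space N" for \<omega>
    using W that unfolding standard_wiener_process_def by blast
  ultimately show ?thesis
    by (rule continuous_joint_measurable[of "\<lambda>\<omega> s. W s \<omega>"])
qed

text \<open>By Tonelli the mean of the integral of |W s| / s is at most the integral of s^(-1/2)
  over [0,1], which is finite; so the inner integral is almost surely finite.\<close>

lemma wiener_AE_div_integrable:
  assumes W: "standard_wiener_process N W"
  shows "AE \<omega> in N. set_integrable lborel {0..1} (\<lambda>s. W s \<omega> / s)"
proof -
  interpret N: prob_space N using W by (simp add: standard_wiener_process_def)
  interpret P: pair_sigma_finite N "lborel :: real measure" ..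
  have [measurable]: "(\<lambda>(\<omega>, s). W (max 0 s) \<omega>) \<in> borel_measurable (N \<Otimes>\<^sub>M lborel)"
    by (rule wiener_joint_measurable[OF W])
  have Wm: "\<And>t. 0 \<le> t \<Longrightarrow> W t \<in> borel_measurable N" using W by (simp add: standard_wiener_process_def)
  define h where "h \<omega> s = (indicator {0..1} s :: real) * \<bar>W (max 0 s) \<omega> / s\<bar>" for \<omega> s
  have [measurable]: "(\<lambda>(\<omega>, s). h \<omega> s) \<in> borel_measurable (N \<Otimes>\<^sub>M lborel)"
    unfolding h_def by measurable
  have "(\<integral>\<^sup>+\<omega>. (\<integral>\<^sup>+s. ennreal (h \<omega> s) \<partial>lborel) \<partial>N) = (\<integral>\<^sup>+s. (\<integral>\<^sup>+\<omega>. ennreal (h \<omega> s) \<partial>N) \<partial>lborel)"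
    by (rule P.Fubini'[symmetric]) measurable
  also have "\<dots> \<le> (\<integral>\<^sup>+s. ennreal (indicator {0..1} s * s powr (- 1 / 2)) \<partial>lborel)"
  proof (rule nn_integral_mono)
    fix s :: real
    show "(\<integral>\<^sup>+\<omega>. ennreal (h \<omega> s) \<partial>N) \<le> ennreal (indicator {0..1} s * s powr (- 1 / 2))"
    proof (cases "s \<in> {0<..1}")
      case True
      then have [measurable]: "W s \<in> borel_measurable N" using Wm by auto
      have "(\<integral>\<^sup>+\<omega>. ennreal (h \<omega> s) \<partial>N) = (\<integral>\<^sup>+\<omega>. ennreal (1 / s) * ennreal \<bar>W s \<omega>\<bar> \<partial>N)"
        using True by (intro nn_integral_cong) (auto simp: h_def ennreal_mult[symmetric] abs_divide)
      also have "\<dots> = ennreal (1 / s) * (\<integral>\<^sup>+\<omega>. ennreal \<bar>W s \<omega>\<bar> \<partial>N)"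
        by (rule nn_integral_cmult) measurable
      also have "\<dots> \<le> ennreal (1 / s) * ennreal (sqrt s)"
        using True by (intro mult_left_mono wiener_abs_moment[OF W]) auto
      also have "\<dots> = ennreal (s powr (- 1 / 2))"
      proof -
        have "1 / s * sqrt s = s powr (-1) * s powr (1/2)" using True by (simp add: powr_minus powr_half_sqrt field_simps)
        also have "\<dots> = s powr (-1/2)" by (simp only: powr_add[symmetric]) simp
        finally show ?thesis using True by (simp add: ennreal_mult[symmetric])
      qed
      finally show ?thesis using True by simp
    next
      case False
      then have "s = 0 \<or> s \<notin> {0..1}" by auto
      then show ?thesis by (auto simp: h_def)
    qed
  qed
  also have "\<dots> = ennreal (1 powr (- 1 / 2 + 1) / (- 1 / 2 + 1))"
  proof (rule nn_integral_has_integral_lborel)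
    have "((\<lambda>s::real. s powr (- 1 / 2)) has_integral 1 powr (- 1 / 2 + 1) / (- 1 / 2 + 1)) {0..1}"
      by (rule has_integral_powr_from_0) auto
    then have "((\<lambda>s::real. if s \<in> {0..1} then s powr (- 1 / 2) else 0) has_integral 1 powr (- 1 / 2 + 1) / (- 1 / 2 + 1)) UNIV"
      by (rule has_integral_restrict_UNIV[THEN iffD2])
    also have "(\<lambda>s::real. if s \<in> {0..1} then s powr (- 1 / 2) else 0) = (\<lambda>s. indicator {0..1} s * s powr (- 1 / 2))"
      by (auto simp: fun_eq_iff indicator_def)
    finally show "((\<lambda>s::real. indicator {0..1} s * s powr (- 1 / 2)) has_integral 1 powr (- 1 / 2 + 1) / (- 1 / 2 + 1)) UNIV" .
    show "(\<lambda>s::real. indicator {0..1} s * s powr (- 1 / 2)) \<in> borel_measurable borel"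
      by measurable
    show "0 \<le> indicator {0..1} s * s powr (- 1 / 2)" for s :: real
      by simp
  qed
  also have "\<dots> < \<infinity>" by simp
  finally have "AE \<omega> in N. (\<integral>\<^sup>+s. ennreal (h \<omega> s) \<partial>lborel) \<noteq> \<infinity>"
    by (intro nn_integral_noteq_infinite) auto
  then show ?thesis
  proof (rule AE_mp, intro AE_I2 impI)
    fix \<omega> assume \<omega>: "\<omega> \<in> space N" and fin: "(\<integral>\<^sup>+s. ennreal (h \<omega> s) \<partial>lborel) \<noteq> \<infinity>"
    have [measurable]: "(\<lambda>s. W (max 0 s) \<omega>) \<in> borel_measurable lborel"
      using measurable_Pair2[OF wiener_joint_measurable[OF W] \<omega>] by simp
    have "integrable lborel (\<lambda>s. indicator {0..1} s * (W (max 0 s) \<omega> / s))"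
    proof (rule integrableI_bounded)
      have "(\<integral>\<^sup>+s. ennreal (norm (indicator {0..1} s * (W (max 0 s) \<omega> / s))) \<partial>lborel) = (\<integral>\<^sup>+s. ennreal (h \<omega> s) \<partial>lborel)"
        by (intro nn_integral_cong) (auto simp: h_def indicator_def)
      then show "(\<integral>\<^sup>+s. ennreal (norm (indicator {0..1} s * (W (max 0 s) \<omega> / s))) \<partial>lborel) < \<infinity>"
        using fin by (simp add: top.not_eq_extremum)
      show "(\<lambda>s. indicator {0..1} s * (W (max 0 s) \<omega> / s)) \<in> borel_measurable lborel"
        by measurable
    qed
    also have "(\<lambda>s. indicator {0..1} s * (W (max 0 s) \<omega> / s)) = (\<lambda>s. indicator {0..1} s *\<^sub>R (W s \<omega> / s))"
      by (auto simp: fun_eq_iff indicator_def)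
    finally show "set_integrable lborel {0..1} (\<lambda>s. W s \<omega> / s)" by (simp add: set_integrable_def)
  qed
qed

section \<open>Comparison of sums and integrals\<close>

text \<open>Within a cell the step path is the constant u j, and q is the integral of the weight
  over (a,b]. Its bounds come from n/(j+1) \<le> 1/s \<le> n/j; the lower one needs the whole piece
  above the cutoff. Arbitrary a and b also cover the incomplete cell at time t.\<close>

lemma cutoff_integral_on_cell:
  fixes u :: "nat \<Rightarrow> real"
  assumes n: "0 < n" and \<epsilon>: "0 < \<epsilon>" and ab: "real j / real n \<le> a" "a \<le> b" "b \<le> real (Suc j) / real n" "b \<le> 1"
  defines "X \<equiv> \<lambda>t. u (nat \<lfloor>real n * t\<rfloor>)"
  shows "\<exists>q. cutoff_integral \<epsilon> X b - cutoff_integral \<epsilon> X a = u j * q \<and> 0 \<le> q \<and>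
    (1 \<le> j \<longrightarrow> q \<le> (b - a) * real n / real j) \<and> (\<epsilon> \<le> a \<longrightarrow> (b - a) * real n / real (Suc j) \<le> q)"
proof -
  let ?w = "\<lambda>s::real. if \<epsilon> \<le> s then 1 / s else 0"
  have n': "0 < real n" using n by simp
  have a0: "0 \<le> a" using ab(1) n by (auto intro: order_trans[rotated])
  have X: "X \<in> D01" unfolding X_def by (rule grid_step_in_D01)
  have XI: "set_integrable lborel {0..b} (\<lambda>s. X s * ?w s)"
    using X \<epsilon> a0 ab by (intro cutoff_set_integrable) auto
  have "(\<lambda>_. 1) \<in> D01" by (intro continuous_imp_D01) auto
  from cutoff_set_integrable[OF this \<epsilon>, of 0 b] have wI0: "set_integrable lborel {0..b} ?w"
    using ab by simp
  have wI: "set_integrable lborel {a<..b} ?w"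
    by (rule set_integrable_subset[OF wI0]) (use a0 in auto)
  have cI: "set_integrable lborel {a<..b} (\<lambda>_. c)" for c :: real
    unfolding set_integrable_def by (intro integrable_scaleR_left integrable_real_indicator) (use ab in auto)
  have cE: "(LINT s:{a<..b}|lborel. c) = (b - a) * c" for c :: real
    using ab by (subst set_integral_const) (auto)
  define q where "q = (LINT s:{a<..b}|lborel. ?w s)"
  have "cutoff_integral \<epsilon> X b = (LINT s:{0..a} \<union> {a<..b}|lborel. X s * ?w s)"
    unfolding cutoff_integral_def using a0 ab by (simp add: ivl_disj_un_two_touch ivl_disj_un)
  also have "\<dots> = cutoff_integral \<epsilon> X a + (LINT s:{a<..b}|lborel. X s * ?w s)"
    unfolding cutoff_integral_def
  proof (rule set_integral_Un)
    show "set_integrable lborel {0..a} (\<lambda>s. X s * ?w s)"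
      by (rule set_integrable_subset[OF XI]) (use ab in auto)
    show "set_integrable lborel {a<..b} (\<lambda>s. X s * ?w s)"
      by (rule set_integrable_subset[OF XI]) (use a0 in auto)
  qed auto
  also have "(LINT s:{a<..b}|lborel. X s * ?w s) = (LINT s:{a<..b}|lborel. u j * ?w s)"
  proof (rule set_lebesgue_integral_cong_AE)
    \<comment> \<open>The point s = b may be the left end of the next cell, where the path already
      has its next value.\<close>
    have "AE s in lborel. s \<noteq> b" by (rule AE_lborel_singleton)
    then show "AE s\<in>{a<..b} in lborel. X s * ?w s = u j * ?w s"
    proof eventually_elim
      case (elim s)
      show ?case
      proof
        assume s: "s \<in> {a<..b}"
        with elim ab have "real j / real n \<le> s" "s < real (Suc j) / real n" by auto
        then have "real j \<le> real n * s" "real n * s < real (Suc j)" 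
          using n' by (simp_all add: pos_divide_le_eq pos_less_divide_eq mult.commute)
        then have "nat \<lfloor>real n * s\<rfloor> = j" by linarith
        then show "X s * ?w s = u j * ?w s" by (simp add: X_def)
      qed
    qed
  qed (use X cutoff_weight_measurable in \<open>auto simp: X_def\<close>)
  also have "\<dots> = u j * q" unfolding q_def by simp
  finally have eq: "cutoff_integral \<epsilon> X b - cutoff_integral \<epsilon> X a = u j * q" by simp
  have "0 \<le> q"
  proof -
    have "(LINT s:{a<..b}|lborel. 0) \<le> q" unfolding q_def
      by (rule set_integral_mono[OF cI wI]) (use \<epsilon> in auto)
    then show ?thesis by simp
  qed
  moreover have "q \<le> (b - a) * real n / real j" if j: "1 \<le> j"
  proof -
    have "q \<le> (LINT s:{a<..b}|lborel. real n / real j)" unfolding q_def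
    proof (rule set_integral_mono[OF wI cI])
      fix s assume "s \<in> {a<..b}"
      with ab have "real j / real n < s" by auto
      then have "real j < s * real n" using n' by (simp add: pos_divide_less_eq)
      moreover from this have "0 < s" using n' j by (smt (verit) mult_nonpos_nonneg of_nat_0_le_iff)
      ultimately show "?w s \<le> real n / real j" using n' j by (auto simp: field_simps)
    qed
    then show ?thesis unfolding cE by simp
  qed
  moreover have "(b - a) * real n / real (Suc j) \<le> q" if \<epsilon>a: "\<epsilon> \<le> a"
  proof -
    have "(LINT s:{a<..b}|lborel. real n / real (Suc j)) \<le> q" unfolding q_def
    proof (rule set_integral_mono[OF cI wI])
      fix s assume s: "s \<in> {a<..b}"
      with ab have "s \<le> real (Suc j) / real n" by auto
      then have "s * real n \<le> real (Suc j)" using n' by (simp add: pos_le_divide_eq)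
      with s \<epsilon> \<epsilon>a show "real n / real (Suc j) \<le> ?w s" by (auto simp: field_simps)
    qed
    then show ?thesis unfolding cE by simp
  qed
  ultimately show ?thesis using eq by blast
qed

text \<open>Cell j contributes u j * q instead of u j / j, an error of |u j / j| * (1 - j * q).
  Above the cutoff 1 - j * q is at most 1/(j+1); in a cell starting below it, only 0 \<le> q is
  known and the factor is at most 1. The integral up to m/n sees the cells below m, hence the range
  {1..<m}.\<close>

lemma cutoff_integral_grid_error:
  fixes u :: "nat \<Rightarrow> real"
  assumes n: "0 < n" and \<epsilon>: "0 < \<epsilon>" and u0: "u 0 = 0" and m: "m \<le> n"
  defines "X \<equiv> \<lambda>t. u (nat \<lfloor>real n * t\<rfloor>)"
  shows "\<bar>cutoff_integral \<epsilon> X (real m / real n) - (\<Sum>k\<in>{1..<m}. u k / real k)\<bar>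
    \<le> (\<Sum>k\<in>{1..<m}. \<bar>u k / real k\<bar> * (1 / real k + (if real k < \<epsilon> * real n then 1 else 0)))"
  using m
proof (induction m)
  case 0
  have "cutoff_integral \<epsilon> X 0 = (LINT s:{0..0::real}|lborel. 0)"
    unfolding cutoff_integral_def using \<epsilon> by (intro set_lebesgue_integral_cong) auto
  then show ?case by simp
next
  case (Suc j)
  have n': "0 < real n" using n by simp
  obtain q where q: "cutoff_integral \<epsilon> X (real (Suc j) / real n) - cutoff_integral \<epsilon> X (real j / real n) = u j * q" "0 \<le> q"
    "1 \<le> j \<longrightarrow> q \<le> (real (Suc j) / real n - real j / real n) * real n / real j"
    "\<epsilon> \<le> real j / real n \<longrightarrow> (real (Suc j) / real n - real j / real n) * real n / real (Suc j) \<le> q"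
    using cutoff_integral_on_cell[OF n \<epsilon>, of j "real j / real n" "real (Suc j) / real n" u] n' Suc.prems
    unfolding X_def by (auto simp: divide_right_mono divide_le_eq)
  have one: "(real (Suc j) / real n - real j / real n) * real n = 1" using n' by (simp add: field_simps)
  show ?case
  proof (cases "j = 0")
    \<comment> \<open>The cell at the origin, where 1/j would be meaningless, contributes nothing
      because u 0 = 0.\<close>
    case True
    with q u0 Suc show ?thesis by simp
  next
    case False
    then have j: "1 \<le> j" by simp
    have q1: "q \<le> 1 / real j" using q(3) j unfolding one by simp
    have q2: "1 / real (Suc j) \<le> q" if "\<not> real j < \<epsilon> * real n"
      using q(4) that n' unfolding one by (simp add: pos_le_divide_eq)
    have "\<bar>u j * q - u j / real j\<bar> = \<bar>u j / real j\<bar> * (1 - real j * q)"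
    proof -
      have "u j * q - u j / real j = - (u j / real j * (1 - real j * q))" using j by (simp add: field_simps)
      moreover have "0 \<le> 1 - real j * q" using q1 j by (simp add: field_simps)
      ultimately show ?thesis by (simp add: abs_mult)
    qed
    also have "\<dots> \<le> \<bar>u j / real j\<bar> * (1 / real j + (if real j < \<epsilon> * real n then 1 else 0))"
    proof (intro mult_left_mono)
      show "1 - real j * q \<le> 1 / real j + (if real j < \<epsilon> * real n then 1 else 0)"
      proof (cases "real j < \<epsilon> * real n")
        case True
        have "0 \<le> real j * q" "0 \<le> 1 / real j" using q(2) by auto
        then have "1 - real j * q \<le> 1 / real j + 1" by linarith
        then show ?thesis using True by simp
      next
        case F: False
        have "real j * (1 / real (Suc j)) \<le> real j * q" using q2[OF F] by (intro mult_left_mono) auto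
        moreover have "1 - real j * (1 / real (Suc j)) = 1 / real (Suc j)" by (simp add: field_simps)
        moreover have "1 / real (Suc j) \<le> 1 / real j" using j by (simp add: frac_le)
        ultimately show ?thesis using F by simp
      qed
    qed auto
    finally have step: "\<bar>u j * q - u j / real j\<bar> \<le> \<bar>u j / real j\<bar> * (1 / real j + (if real j < \<epsilon> * real n then 1 else 0))" .
    have "{1..<Suc j} = insert j {1..<j}" using j by auto
    then have sums: "(\<Sum>k\<in>{1..<Suc j}. f k) = f j + (\<Sum>k\<in>{1..<j}. f k)" for f :: "nat \<Rightarrow> real" by simp
    show ?thesis unfolding sums using step Suc.IH Suc.prems q(1) by linarith
  qed
qed

text \<open>The three copies of L come from the incomplete last cell, from the summand k = m absent
  from the grid sum, and from the constant in the hypothesis on the errors. The last sum collects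
  the cells starting below \<epsilon>.\<close>

lemma log_sum_cutoff_error:
  fixes c :: "nat \<Rightarrow> real"
  assumes n: "0 < n" and \<epsilon>: "0 < \<epsilon>" and \<kappa>: "0 \<le> \<kappa>" and L: "\<And>k. \<bar>c k\<bar> \<le> L"
    and sum: "(\<Sum>k=1..n. \<bar>ln (1 + c k) - c k\<bar> + \<bar>c k\<bar> / real k) \<le> L + \<delta> * (\<Sum>k=1..n. \<bar>c k\<bar>)"
  shows "unif_close (\<kappa> * (3 * L + \<delta> * (\<Sum>k=1..n. \<bar>c k\<bar>) + (\<Sum>k=1..nat \<lfloor>\<epsilon> * real n\<rfloor>. \<bar>c k\<bar>)))
    (\<lambda>t. \<kappa> * (\<Sum>k=1..nat \<lfloor>real n * t\<rfloor>. ln (1 + c k)))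
    (cutoff_integral \<epsilon> (\<lambda>t. \<kappa> * (real (nat \<lfloor>real n * t\<rfloor>) * c (nat \<lfloor>real n * t\<rfloor>))))"
  unfolding unif_close_def
proof
  fix t :: real assume t: "t \<in> {0..1}"
  have n': "0 < real n" using n by simp
  define u where "u k = \<kappa> * (real k * c k)" for k
  define m where "m = nat \<lfloor>real n * t\<rfloor>"
  define U where "U = cutoff_integral \<epsilon> (\<lambda>t. u (nat \<lfloor>real n * t\<rfloor>))"
  let ?I = "\<lambda>k. if real k < \<epsilon> * real n then 1 else 0 :: real"
  have nt: "0 \<le> real n * t" "real n * t \<le> real n" using t by (simp_all add: mult_left_le)
  have mnt: "real m \<le> real n * t" "real n * t < real (Suc m)" unfolding m_def using nt by linarith+
  have mn: "m \<le> n" using mnt nt by linarith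
  have uk: "u k / real k = \<kappa> * c k" if "1 \<le> k" for k using that by (simp add: u_def)
  have "\<bar>U (real m / real n) - (\<Sum>k\<in>{1..<m}. u k / real k)\<bar>
      \<le> (\<Sum>k\<in>{1..<m}. \<bar>u k / real k\<bar> * (1 / real k + ?I k))"
    unfolding U_def by (rule cutoff_integral_grid_error[OF n \<epsilon> _ mn]) (simp add: u_def)
  also have "(\<Sum>k\<in>{1..<m}. u k / real k) = \<kappa> * (\<Sum>k\<in>{1..<m}. c k)"
    by (simp add: uk sum_distrib_left)
  also have "(\<Sum>k\<in>{1..<m}. \<bar>u k / real k\<bar> * (1 / real k + ?I k)) = \<kappa> * (\<Sum>k\<in>{1..<m}. \<bar>c k\<bar> / real k + \<bar>c k\<bar> * ?I k)"
    unfolding sum_distrib_left using \<kappa> by (intro sum.cong) (auto simp: uk abs_mult algebra_simps)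
  finally have 1: "\<bar>U (real m / real n) - \<kappa> * (\<Sum>k\<in>{1..<m}. c k)\<bar> \<le> \<kappa> * (\<Sum>k\<in>{1..<m}. \<bar>c k\<bar> / real k + \<bar>c k\<bar> * ?I k)" .
  have 2: "\<bar>U t - U (real m / real n)\<bar> \<le> \<kappa> * L"
  proof -
    have "real m / real n \<le> t" "t \<le> real (Suc m) / real n"
      using mnt n' by (simp_all add: pos_divide_le_eq pos_le_divide_eq mult.commute)
    from cutoff_integral_on_cell[OF n \<epsilon> order_refl this, of u] t
    obtain q where q: "U t - U (real m / real n) = u m * q" "0 \<le> q"
      "1 \<le> m \<longrightarrow> q \<le> (t - real m / real n) * real n / real m" unfolding U_def by auto
    show ?thesis
    proof (cases "m = 0")
      case True
      then show ?thesis using q(1) \<kappa> order_trans[OF abs_ge_zero L[of 0]] by (simp add: u_def)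
    next
      case False
      have "(t - real m / real n) * real n \<le> 1" using mnt n' by (simp add: left_diff_distrib mult.commute[of t])
      then have "(t - real m / real n) * real n / real m \<le> 1 / real m" by (intro divide_right_mono) auto
      with q(3) False have "q \<le> 1 / real m" by simp
      then have "real m * q \<le> 1" using False by (simp add: field_simps)
      have "\<bar>u m * q\<bar> = \<kappa> * \<bar>c m\<bar> * (real m * q)" using \<kappa> q(2) by (simp add: u_def abs_mult)
      also have "\<dots> \<le> \<kappa> * \<bar>c m\<bar> * 1" using \<open>real m * q \<le> 1\<close> \<kappa> by (intro mult_left_mono) auto
      also have "\<dots> \<le> \<kappa> * L" using L[of m] \<kappa> by (simp add: mult_left_mono)
      finally show ?thesis unfolding q(1) .
    qed
  qed
  have 3: "\<bar>\<kappa> * (\<Sum>k=1..m. c k) - \<kappa> * (\<Sum>k\<in>{1..<m}. c k)\<bar> \<le> \<kappa> * L"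
  proof (cases "m = 0")
    case True
    then show ?thesis using \<kappa> order_trans[OF abs_ge_zero L[of 0]] by simp
  next
    case False
    then have "{1..m} = insert m {1..<m}" by auto
    then have "\<kappa> * (\<Sum>k=1..m. c k) - \<kappa> * (\<Sum>k\<in>{1..<m}. c k) = \<kappa> * c m" by (simp add: algebra_simps)
    then show ?thesis using \<kappa> L[of m] by (simp add: abs_mult mult_left_mono)
  qed
  have 4: "\<bar>\<kappa> * (\<Sum>k=1..m. ln (1 + c k)) - \<kappa> * (\<Sum>k=1..m. c k)\<bar> \<le> \<kappa> * (\<Sum>k=1..m. \<bar>ln (1 + c k) - c k\<bar>)"
  proof -
    have "\<kappa> * (\<Sum>k=1..m. ln (1 + c k)) - \<kappa> * (\<Sum>k=1..m. c k) = \<kappa> * (\<Sum>k=1..m. ln (1 + c k) - c k)"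
      by (simp add: sum_subtractf algebra_simps)
    then show ?thesis using \<kappa> sum_abs[of "\<lambda>k. ln (1 + c k) - c k" "{1..m}"] by (simp add: abs_mult mult_left_mono)
  qed
  have 5: "(\<Sum>k=1..m. \<bar>ln (1 + c k) - c k\<bar>) + (\<Sum>k\<in>{1..<m}. \<bar>c k\<bar> / real k + \<bar>c k\<bar> * ?I k) 
     \<le> L + \<delta> * (\<Sum>k=1..n. \<bar>c k\<bar>) + (\<Sum>k=1..nat \<lfloor>\<epsilon> * real n\<rfloor>. \<bar>c k\<bar>)"
  proof -
    have "(\<Sum>k=1..m. \<bar>ln (1 + c k) - c k\<bar>) \<le> (\<Sum>k=1..n. \<bar>ln (1 + c k) - c k\<bar>)"
      using mn by (intro sum_mono2) auto
    moreover have "(\<Sum>k\<in>{1..<m}. \<bar>c k\<bar> / real k) \<le> (\<Sum>k=1..n. \<bar>c k\<bar> / real k)"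
      using mn by (intro sum_mono2) auto
    moreover have "(\<Sum>k\<in>{1..<m}. \<bar>c k\<bar> * ?I k) = (\<Sum>k\<in>{k\<in>{1..<m}. real k < \<epsilon> * real n}. \<bar>c k\<bar>)"
      by (subst sum.inter_filter) (auto intro!: sum.cong)
    moreover have "(\<Sum>k\<in>{k\<in>{1..<m}. real k < \<epsilon> * real n}. \<bar>c k\<bar>) \<le> (\<Sum>k=1..nat \<lfloor>\<epsilon> * real n\<rfloor>. \<bar>c k\<bar>)"
      by (intro sum_mono2) (auto simp: le_nat_floor)
    moreover note sum
    ultimately show ?thesis by (simp add: sum.distrib)
  qed
  have "\<bar>\<kappa> * (\<Sum>k=1..m. ln (1 + c k)) - U t\<bar> \<le> \<kappa> * (\<Sum>k=1..m. \<bar>ln (1 + c k) - c k\<bar>) + \<kappa> * L + \<kappa> * L +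
      \<kappa> * (\<Sum>k\<in>{1..<m}. \<bar>c k\<bar> / real k + \<bar>c k\<bar> * ?I k)"
    using 1 2 3 4 by linarith
  also have "\<dots> = \<kappa> * ((\<Sum>k=1..m. \<bar>ln (1 + c k) - c k\<bar>) + (\<Sum>k\<in>{1..<m}. \<bar>c k\<bar> / real k + \<bar>c k\<bar> * ?I k) + 2 * L)"
    by (simp add: algebra_simps)
  also have "\<dots> \<le> \<kappa> * (3 * L + \<delta> * (\<Sum>k=1..n. \<bar>c k\<bar>) + (\<Sum>k=1..nat \<lfloor>\<epsilon> * real n\<rfloor>. \<bar>c k\<bar>))"
    using 5 \<kappa> by (intro mult_left_mono) auto
  finally show "\<bar>\<kappa> * (\<Sum>k=1..nat \<lfloor>real n * t\<rfloor>. ln (1 + c k)) - 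
      cutoff_integral \<epsilon> (\<lambda>t. \<kappa> * (real (nat \<lfloor>real n * t\<rfloor>) * c (nat \<lfloor>real n * t\<rfloor>))) t\<bar>
      \<le> \<kappa> * (3 * L + \<delta> * (\<Sum>k=1..n. \<bar>c k\<bar>) + (\<Sum>k=1..nat \<lfloor>\<epsilon> * real n\<rfloor>. \<bar>c k\<bar>))"
    unfolding U_def u_def m_def .
qed

text \<open>Both errors are o(|c k|): the logarithmic one is quadratic and the other carries 1/k.
  The finitely many early indices are absorbed in L, a natural number so that a countable family of
  events can be indexed by it.\<close>

lemma log_error_linear_bound:
  fixes c :: "nat \<Rightarrow> real"
  assumes c: "c \<longlonglongrightarrow> 0" and \<delta>: "0 < \<delta>"
  shows "\<exists>L::nat. (\<forall>k. \<bar>c k\<bar> \<le> real L) \<and>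
    (\<forall>n. (\<Sum>k=1..n. \<bar>ln (1 + c k) - c k\<bar> + \<bar>c k\<bar> / real k) \<le> real L + \<delta> * (\<Sum>k=1..n. \<bar>c k\<bar>))"
proof -
  define e where "e k = \<bar>ln (1 + c k) - c k\<bar> + \<bar>c k\<bar> / real k" for k
  have "(\<lambda>k. \<bar>c k\<bar>) \<longlonglongrightarrow> 0" using tendsto_rabs_zero[OF c] .
  \<comment> \<open>The bound 1/2 is the range of the quadratic estimate of the logarithm;
    \<delta>/4 makes 2 |c k| at most \<delta>/2, leaving the other half for 1/k.\<close>
  then have "eventually (\<lambda>k. \<bar>c k\<bar> < min (1/2) (\<delta>/4)) sequentially"
    using \<delta> by (intro order_tendstoD(2)) auto
  moreover have "eventually (\<lambda>k. 1 / real k < \<delta> / 2) sequentially"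
    using \<delta> by (intro order_tendstoD(2)[OF lim_1_over_n]) auto
  ultimately have "eventually (\<lambda>k. e k \<le> \<delta> * \<bar>c k\<bar>) sequentially"
  proof eventually_elim
    case (elim k)
    have "\<bar>ln (1 + c k) - c k\<bar> \<le> 2 * (c k)\<^sup>2" using elim by (intro abs_ln_one_plus_x_minus_x_bound) auto
    also have "\<dots> = (2 * \<bar>c k\<bar>) * \<bar>c k\<bar>" by (simp add: power2_eq_square)
    also have "\<dots> \<le> (\<delta> / 2) * \<bar>c k\<bar>" using elim by (intro mult_right_mono) auto
    finally have "\<bar>ln (1 + c k) - c k\<bar> \<le> (\<delta> / 2) * \<bar>c k\<bar>" .
    moreover have "\<bar>c k\<bar> / real k \<le> (\<delta> / 2) * \<bar>c k\<bar>"
      using mult_right_mono[of "1 / real k" "\<delta> / 2" "\<bar>c k\<bar>"] elim by simp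
    moreover have "\<delta> * \<bar>c k\<bar> = (\<delta> / 2) * \<bar>c k\<bar> + (\<delta> / 2) * \<bar>c k\<bar>" by simp
    ultimately show ?case unfolding e_def by linarith
  qed
  then obtain K where K: "\<And>k. k \<ge> K \<Longrightarrow> e k \<le> \<delta> * \<bar>c k\<bar>" by (auto simp: eventually_sequentially)
  have "Bseq c" using c by (auto intro: convergent_imp_Bseq convergentI)
  then obtain b where b: "\<forall>k. norm (c k) \<le> b" by (rule BseqE)
  obtain L :: nat where L: "max b (\<Sum>k<K. e k) \<le> real L" using real_arch_simple by blast
  have e0: "0 \<le> e k" for k by (simp add: e_def)
  have "(\<Sum>k=1..n. e k) \<le> real L + \<delta> * (\<Sum>k=1..n. \<bar>c k\<bar>)" for n
  proof -
    have "(\<Sum>k=1..n. e k) \<le> (\<Sum>k=1..n. (if k < K then e k else 0) + \<delta> * \<bar>c k\<bar>)"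
      using K \<delta> by (intro sum_mono) (auto simp: not_less)
    also have "\<dots> = (\<Sum>k=1..n. if k < K then e k else 0) + \<delta> * (\<Sum>k=1..n. \<bar>c k\<bar>)"
      by (simp add: sum.distrib sum_distrib_left)
    also have "(\<Sum>k=1..n. if k < K then e k else 0) = (\<Sum>k\<in>{k\<in>{1..n}. k < K}. e k)"
      by (subst sum.inter_filter) auto
    also have "\<dots> \<le> (\<Sum>k<K. e k)" using e0 by (intro sum_mono2) auto
    finally show ?thesis using L by simp
  qed
  moreover have "\<bar>c k\<bar> \<le> real L" for k using b[rule_format, of k] L by simp
  ultimately show ?thesis unfolding e_def by blast
qed

text \<open>For j^4 \<le> k < (j+1)^4 monotonicity puts s k / k between s(j^4)/(j+1)^4 and
  s((j+1)^4)/j^4; both tend to \<mu> because ((j+1)/j)^4 tends to 1.\<close>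

lemma monotone_ratio_tendsto:
  fixes s :: "nat \<Rightarrow> real"
  assumes pos: "\<And>k. 1 \<le> k \<Longrightarrow> 0 < s k" and mono: "\<And>k. 1 \<le> k \<Longrightarrow> s k \<le> s (Suc k)"
    and lim: "(\<lambda>j. s (Suc j ^ 4) / real (Suc j ^ 4)) \<longlonglongrightarrow> \<mu>"
  shows "(\<lambda>k. s k / real k) \<longlonglongrightarrow> \<mu>"
proof -
  have mono': "s a \<le> s b" if "1 \<le> a" "a \<le> b" for a b
    using that(2,1) by (induction rule: dec_induct) (use mono in \<open>auto intro: order_trans\<close>)
  define j where "j k = nat \<lfloor>root 4 (real k)\<rfloor>" for k
  have j: "j k ^ 4 \<le> k" "k < Suc (j k) ^ 4" for k
  proof -
    have r: "0 \<le> root 4 (real k)" by simp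
    have r4: "root 4 (real k) ^ 4 = real k" by simp
    have "real (j k) \<le> root 4 (real k)" unfolding j_def using r by linarith
    from power_mono[OF this, of 4] have "real (j k ^ 4) \<le> real k" unfolding r4 by simp
    then show "j k ^ 4 \<le> k" by linarith
    have "root 4 (real k) < real (Suc (j k))" unfolding j_def using r by linarith
    from power_strict_mono[OF this r, of 4] have "real k < real (Suc (j k) ^ 4)" unfolding r4 by simp
    then show "k < Suc (j k) ^ 4" by linarith
  qed
  have jtop: "filterlim j at_top sequentially"
    unfolding filterlim_at_top
  proof
    fix Z :: nat
    show "eventually (\<lambda>k. Z \<le> j k) sequentially"
      unfolding eventually_sequentially
    proof (intro exI[of _ "Z ^ 4"] allI impI)
      fix k assume "Z ^ 4 \<le> k"
      with j(2)[of k] have "Z ^ 4 < Suc (j k) ^ 4" by linarith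
      then have "Z < Suc (j k)" by (rule power_less_imp_less_base) simp
      then show "Z \<le> j k" by simp
    qed
  qed
  have q: "(\<lambda>j. (real (Suc j) / real j) ^ 4) \<longlonglongrightarrow> 1 ^ 4"
    by (intro tendsto_power LIMSEQ_Suc_n_over_n)
  have q': "(\<lambda>j. (real j / real (Suc j)) ^ 4) \<longlonglongrightarrow> 1 ^ 4"
    by (intro tendsto_power LIMSEQ_n_over_Suc_n)
  have lim0: "(\<lambda>j. s (j ^ 4) / real (j ^ 4)) \<longlonglongrightarrow> \<mu>"
    by (rule LIMSEQ_imp_Suc) (use lim in simp)
  have up: "(\<lambda>j. s (Suc j ^ 4) / real (Suc j ^ 4) * (real (Suc j) / real j) ^ 4) \<longlonglongrightarrow> \<mu>"
    using tendsto_mult[OF lim q] by simp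
  have lo: "(\<lambda>j. s (j ^ 4) / real (j ^ 4) * (real j / real (Suc j)) ^ 4) \<longlonglongrightarrow> \<mu>"
    using tendsto_mult[OF lim0 q'] by simp
  have ge1: "eventually (\<lambda>k. 1 \<le> j k) sequentially"
    using jtop by (simp add: filterlim_at_top)
  show ?thesis
  proof (rule tendsto_sandwich[OF _ _ filterlim_compose[OF lo jtop] filterlim_compose[OF up jtop]])
    show "eventually (\<lambda>k. s (j k ^ 4) / real (j k ^ 4) * (real (j k) / real (Suc (j k))) ^ 4 \<le> s k / real k) sequentially"
      using ge1
    proof eventually_elim
      case (elim k)
      have "s (j k ^ 4) / real (j k ^ 4) * (real (j k) / real (Suc (j k))) ^ 4 = s (j k ^ 4) / real (Suc (j k) ^ 4)"
        using elim by (simp add: power_divide)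
      also have "\<dots> \<le> s k / real k"
      proof (rule frac_le)
        show "s (j k ^ 4) \<le> s k" using elim j(1) by (intro mono') auto
        show "0 \<le> s k" using pos[of k] j(1)[of k] elim by (metis le_trans less_imp_le one_le_power)
        show "0 < real k" using j(1)[of k] elim by (metis le_trans of_nat_0_less_iff one_le_power less_le_trans zero_less_one)
        show "real k \<le> real (Suc (j k) ^ 4)" using j(2)[of k] by linarith
      qed
      finally show ?case .
    qed
    show "eventually (\<lambda>k. s k / real k \<le> s (Suc (j k) ^ 4) / real (Suc (j k) ^ 4) * (real (Suc (j k)) / real (j k)) ^ 4) sequentially"
      using ge1
    proof eventually_elim
      case (elim k)
      have k: "1 \<le> k" using j(1)[of k] elim by (metis le_trans one_le_power)
      have "s k / real k \<le> s (Suc (j k) ^ 4) / real (j k ^ 4)"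
      proof (rule frac_le)
        show "s k \<le> s (Suc (j k) ^ 4)" using k j(2)[of k] by (intro mono') auto
        show "0 \<le> s (Suc (j k) ^ 4)" using pos[of "Suc (j k) ^ 4"] by (simp add: less_imp_le)
        show "0 < real (j k ^ 4)" using elim by simp
        show "real (j k ^ 4) \<le> real k" using j(1)[of k] by linarith
      qed
      also have "\<dots> = s (Suc (j k) ^ 4) / real (Suc (j k) ^ 4) * (real (Suc (j k)) / real (j k)) ^ 4"
        by (simp add: power_divide del: of_nat_Suc)
      finally show ?case .
    qed
  qed
qed

text \<open>A telescoping bound: the conjugate product of neighbouring square roots is 1, so
  1/sqrt(m+1) is at most twice their difference.\<close>

lemma sum_inverse_sqrt_le: "(\<Sum>k=1..m. 1 / sqrt (real k)) \<le> 2 * sqrt (real m)"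
proof (induction m)
  case (Suc m)
  have "1 / sqrt (real (Suc m)) \<le> 2 * (sqrt (real (Suc m)) - sqrt (real m))"
  proof -
    have "sqrt (real m) \<le> sqrt (real (Suc m))" by simp
    then have "sqrt (real (Suc m)) + sqrt (real m) \<le> 2 * sqrt (real (Suc m))" by simp
    moreover have "(sqrt (real (Suc m)) - sqrt (real m)) * (sqrt (real (Suc m)) + sqrt (real m)) = 1"
      by (simp add: algebra_simps)
    ultimately have "1 \<le> (sqrt (real (Suc m)) - sqrt (real m)) * (2 * sqrt (real (Suc m)))"
      by (metis \<open>sqrt (real m) \<le> sqrt (real (Suc m))\<close> diff_ge_0_iff_ge mult_left_mono)
    moreover have "0 < sqrt (real (Suc m))" by simp
    ultimately show ?thesis by (simp only: pos_divide_le_eq mult_ac)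
  qed
  with Suc show ?case by simp
qed simp

section \<open>Partial sums\<close>

locale monotone_sums = prob_space M for M :: "'a measure" +
  fixes S :: "nat \<Rightarrow> 'a \<Rightarrow> real" and \<mu> \<sigma> C :: real
  assumes S_measurable: "\<And>k. 1 \<le> k \<Longrightarrow> S k \<in> borel_measurable M"
    and S_pos: "\<And>k \<omega>. 1 \<le> k \<Longrightarrow> \<omega> \<in> space M \<Longrightarrow> 0 < S k \<omega>"
    and S_mono: "\<And>k \<omega>. 1 \<le> k \<Longrightarrow> \<omega> \<in> space M \<Longrightarrow> S k \<omega> \<le> S (Suc k) \<omega>"
    and \<mu>_pos: "0 < \<mu>" and \<sigma>_pos: "0 < \<sigma>" and C_nonneg: "0 \<le> C"
    and S_moment: "\<And>n. 1 \<le> n \<Longrightarrow> (\<integral>\<^sup>+\<omega>. ennreal \<bar>S n \<omega> - real n * \<mu>\<bar> \<partial>M) \<le> ennreal (C * sqrt (real n))"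
begin

text \<open>The relative deviation, so that 1 + R k is the k-th factor of the product.
  \<open>S 0\<close> is unconstrained; the value 0 at index 0 makes the partial-sum path vanish on
  the first grid cell.\<close>

definition R :: "nat \<Rightarrow> 'a \<Rightarrow> real" where
  "R k \<omega> = (if k = 0 then 0 else S k \<omega> / (real k * \<mu>) - 1)"

definition \<kappa> :: "nat \<Rightarrow> real" where
  "\<kappa> n = \<mu> / \<sigma> / sqrt (real n)"

definition log_path :: "nat \<Rightarrow> 'a \<Rightarrow> real \<Rightarrow> real" where
  "log_path n \<omega> t = \<kappa> n * (\<Sum>k=1..nat \<lfloor>real n * t\<rfloor>. ln (1 + R k \<omega>))"

text \<open>This is the normalised process \<open>W\<^sub>n\<close> of the hypothesis, written so
  that dividing its k-th value by k leaves \<kappa> n * R k, the linear term of the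
  logarithm.\<close>

definition sum_path :: "nat \<Rightarrow> 'a \<Rightarrow> real \<Rightarrow> real" where
  "sum_path n \<omega> t = \<kappa> n * (real (nat \<lfloor>real n * t\<rfloor>) * R (nat \<lfloor>real n * t\<rfloor>) \<omega>)"

lemma log_path_fun: "log_path n = (\<lambda>\<omega> t. \<kappa> n * (\<Sum>k=1..nat \<lfloor>real n * t\<rfloor>. ln (1 + R k \<omega>)))"
  by (intro ext) (rule log_path_def)

lemma sum_path_fun: "sum_path n = (\<lambda>\<omega> t. \<kappa> n * (real (nat \<lfloor>real n * t\<rfloor>) * R (nat \<lfloor>real n * t\<rfloor>) \<omega>))"
  by (intro ext) (rule sum_path_def)

lemma \<kappa>_nonneg: "0 \<le> \<kappa> n"
  using \<mu>_pos \<sigma>_pos by (simp add: \<kappa>_def)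

lemma R_measurable [measurable]: "R k \<in> borel_measurable M"
proof (cases "k = 0")
  case True
  then have "R k = (\<lambda>\<omega>. 0)" by (intro ext) (simp add: R_def)
  then show ?thesis by simp
next
  case False
  then have [measurable]: "S k \<in> borel_measurable M" using S_measurable by simp
  have "R k = (\<lambda>\<omega>. S k \<omega> / (real k * \<mu>) - 1)" using False by (intro ext) (simp add: R_def)
  then show ?thesis by simp
qed

lemma sum_path_eq:
  "sum_path n \<omega> t = ((if nat \<lfloor>real n * t\<rfloor> = 0 then 0 else S (nat \<lfloor>real n * t\<rfloor>) \<omega>) - real (nat \<lfloor>real n * t\<rfloor>) * \<mu>) / (\<sigma> * sqrt (real n))"
proof -
  have *: "\<mu> * (real k * (S k \<omega> / (real k * \<mu>) - 1)) = S k \<omega> - real k * \<mu>" if "k \<noteq> 0" for k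
    using \<mu>_pos that by (simp add: field_simps)
  define k where "k = nat \<lfloor>real n * t\<rfloor>"
  show ?thesis
    unfolding sum_path_def \<kappa>_def R_def times_divide_eq_left divide_divide_eq_left k_def[symmetric] by (simp add: *)
qed

lemma exp_log_path:
  assumes \<omega>: "\<omega> \<in> space M"
  shows "exp (log_path n \<omega> t) = (\<Prod>k\<in>{1..nat \<lfloor>real n * t\<rfloor>}. S k \<omega> / (real k * \<mu>)) powr ((\<mu> / \<sigma>) / sqrt (real n))"
proof -
  let ?m = "nat \<lfloor>real n * t\<rfloor>"
  have pos: "0 < S k \<omega> / (real k * \<mu>)" if "k \<in> {1..?m}" for k
    using that S_pos[OF _ \<omega>] \<mu>_pos by auto
  have "(\<Sum>k=1..?m. ln (1 + R k \<omega>)) = (\<Sum>k=1..?m. ln (S k \<omega> / (real k * \<mu>)))"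
    by (intro sum.cong) (auto simp: R_def)
  also have "\<dots> = ln (\<Prod>k\<in>{1..?m}. S k \<omega> / (real k * \<mu>))"
    by (rule ln_prod[symmetric]) (use pos in force)+
  finally have "log_path n \<omega> t = \<kappa> n * ln (\<Prod>k\<in>{1..?m}. S k \<omega> / (real k * \<mu>))"
    by (simp add: log_path_def)
  moreover have "0 < (\<Prod>k\<in>{1..?m}. S k \<omega> / (real k * \<mu>))" using pos by (intro prod_pos) auto
  ultimately show ?thesis unfolding powr_def \<kappa>_def by (metis less_irrefl)
qed

lemma R_abs_nn_integral:
  assumes k: "1 \<le> k"
  shows "(\<integral>\<^sup>+\<omega>. ennreal \<bar>R k \<omega>\<bar> \<partial>M) \<le> ennreal (C / \<mu> * (1 / sqrt (real k)))"
proof -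
  have [measurable]: "S k \<in> borel_measurable M" using S_measurable k by simp
  have k\<mu>: "0 < real k * \<mu>" using k \<mu>_pos by simp
  have "(\<integral>\<^sup>+\<omega>. ennreal \<bar>R k \<omega>\<bar> \<partial>M) = (\<integral>\<^sup>+\<omega>. ennreal (1 / (real k * \<mu>)) * ennreal \<bar>S k \<omega> - real k * \<mu>\<bar> \<partial>M)"
  proof (intro nn_integral_cong)
    fix \<omega>
    have "R k \<omega> = 1 / (real k * \<mu>) * (S k \<omega> - real k * \<mu>)" using k k\<mu> \<mu>_pos by (simp add: R_def field_simps)
    then have "\<bar>R k \<omega>\<bar> = 1 / (real k * \<mu>) * \<bar>S k \<omega> - real k * \<mu>\<bar>" using k\<mu> \<mu>_pos by (simp add: abs_mult)
    then show "ennreal \<bar>R k \<omega>\<bar> = ennreal (1 / (real k * \<mu>)) * ennreal \<bar>S k \<omega> - real k * \<mu>\<bar>"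
      using k\<mu> \<mu>_pos by (subst \<open>\<bar>R k \<omega>\<bar> = _\<close>, intro ennreal_mult) auto
  qed
  also have "\<dots> = ennreal (1 / (real k * \<mu>)) * (\<integral>\<^sup>+\<omega>. ennreal \<bar>S k \<omega> - real k * \<mu>\<bar> \<partial>M)"
    by (rule nn_integral_cmult) measurable
  also have "\<dots> \<le> ennreal (1 / (real k * \<mu>)) * ennreal (C * sqrt (real k))"
    by (intro mult_left_mono S_moment k) auto
  also have "\<dots> = ennreal (1 / (real k * \<mu>) * (C * sqrt (real k)))"
    using k\<mu> C_nonneg by (intro ennreal_mult[symmetric]) auto
  also have "1 / (real k * \<mu>) * (C * sqrt (real k)) = C / \<mu> * (1 / sqrt (real k))"
    using k \<mu>_pos real_div_sqrt[of "real k"] by (simp add: field_simps)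
  finally show ?thesis .
qed

lemma R_integrable: "integrable M (\<lambda>\<omega>. \<bar>R k \<omega>\<bar>)"
proof (cases "1 \<le> k")
  case True
  show ?thesis
  proof (rule integrableI_bounded)
    show "(\<integral>\<^sup>+\<omega>. ennreal (norm \<bar>R k \<omega>\<bar>) \<partial>M) < \<infinity>"
      using le_less_trans[OF R_abs_nn_integral[OF True] ennreal_less_top] by simp
  qed measurable
qed (simp add: R_def)

lemma R_abs_expectation: "1 \<le> k \<Longrightarrow> expectation (\<lambda>\<omega>. \<bar>R k \<omega>\<bar>) \<le> C / \<mu> * (1 / sqrt (real k))"
  using R_abs_nn_integral[of k] nn_integral_eq_integral[OF R_integrable[of k]] C_nonneg \<mu>_pos
  by (simp add: ennreal_le_iff)

text \<open>The order \<open>sqrt m\<close> is exactly what the factor \<kappa> n compensates for m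
  = n, and it leaves \<open>sqrt \<epsilon>\<close> for m about \<epsilon> n.\<close>

lemma R_sum_expectation: "expectation (\<lambda>\<omega>. \<Sum>k=1..m. \<bar>R k \<omega>\<bar>) \<le> 2 * C / \<mu> * sqrt (real m)"
proof -
  have "expectation (\<lambda>\<omega>. \<Sum>k=1..m. \<bar>R k \<omega>\<bar>) = (\<Sum>k=1..m. expectation (\<lambda>\<omega>. \<bar>R k \<omega>\<bar>))"
    by (rule Bochner_Integration.integral_sum) (rule R_integrable)
  also have "\<dots> \<le> (\<Sum>k=1..m. C / \<mu> * (1 / sqrt (real k)))"
    by (intro sum_mono R_abs_expectation) auto
  also have "\<dots> = C / \<mu> * (\<Sum>k=1..m. 1 / sqrt (real k))" by (simp add: sum_distrib_left)
  also have "\<dots> \<le> C / \<mu> * (2 * sqrt (real m))"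
    using C_nonneg \<mu>_pos by (intro mult_left_mono sum_inverse_sqrt_le) auto
  finally show ?thesis by (simp add: mult_ac)
qed

text \<open>The moment bound is summable along fourth powers, and monotonicity fills the gaps.\<close>
lemma R_tendsto_0: "AE \<omega> in M. (\<lambda>k. R k \<omega>) \<longlonglongrightarrow> 0"
proof -
  have "(\<integral>\<^sup>+\<omega>. (\<Sum>j. ennreal \<bar>R (Suc j ^ 4) \<omega>\<bar>) \<partial>M) = (\<Sum>j. \<integral>\<^sup>+\<omega>. ennreal \<bar>R (Suc j ^ 4) \<omega>\<bar> \<partial>M)"
    by (rule nn_integral_suminf) measurable
  also have "\<dots> \<le> (\<Sum>j. ennreal (C / \<mu> * (1 / real (Suc j) ^ 2)))"
  proof (intro suminf_le)
    fix j
    have "sqrt (real (Suc j ^ 4)) = real (Suc j) ^ 2"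
      by (rule real_sqrt_unique) (simp_all flip: power_mult)
    then show "(\<integral>\<^sup>+\<omega>. ennreal \<bar>R (Suc j ^ 4) \<omega>\<bar> \<partial>M) \<le> ennreal (C / \<mu> * (1 / real (Suc j) ^ 2))"
      using R_abs_nn_integral[of "Suc j ^ 4"] by simp
  qed auto
  also have "\<dots> = ennreal (\<Sum>j. C / \<mu> * (1 / real (Suc j) ^ 2))"
  proof (rule suminf_ennreal2)
    have "summable (\<lambda>j. inverse (real j ^ 2))" by (rule inverse_power_summable) simp
    then have "summable (\<lambda>j. 1 / real (Suc j) ^ 2)"
      by (subst (asm) summable_Suc_iff[symmetric]) (simp add: inverse_eq_divide)
    then show "summable (\<lambda>j. C / \<mu> * (1 / real (Suc j) ^ 2))" by (rule summable_mult)
  qed (use C_nonneg \<mu>_pos in auto)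
  also have "\<dots> < \<infinity>" by simp
  finally have "AE \<omega> in M. (\<Sum>j. ennreal \<bar>R (Suc j ^ 4) \<omega>\<bar>) \<noteq> \<infinity>"
    by (intro nn_integral_noteq_infinite) auto
  then show ?thesis
  proof (rule AE_mp, intro AE_I2 impI)
    fix \<omega> assume \<omega>: "\<omega> \<in> space M" and fin: "(\<Sum>j. ennreal \<bar>R (Suc j ^ 4) \<omega>\<bar>) \<noteq> \<infinity>"
    have "summable (\<lambda>j. \<bar>R (Suc j ^ 4) \<omega>\<bar>)"
      using fin by (intro summable_suminf_not_top) auto
    then have "(\<lambda>j. \<bar>R (Suc j ^ 4) \<omega>\<bar>) \<longlonglongrightarrow> 0" by (rule summable_LIMSEQ_zero)
    then have "(\<lambda>j. R (Suc j ^ 4) \<omega>) \<longlonglongrightarrow> 0" by (simp add: tendsto_rabs_zero_iff)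
    then have "(\<lambda>j. \<mu> * (1 + R (Suc j ^ 4) \<omega>)) \<longlonglongrightarrow> \<mu> * (1 + 0)" by (intro tendsto_intros)
    moreover have "\<mu> * (1 + R k \<omega>) = S k \<omega> / real k" if "k \<noteq> 0" for k
      using that \<mu>_pos by (simp add: R_def)
    then have "(\<lambda>j. \<mu> * (1 + R (Suc j ^ 4) \<omega>)) = (\<lambda>j. S (Suc j ^ 4) \<omega> / real (Suc j ^ 4))" by auto
    ultimately have "(\<lambda>j. S (Suc j ^ 4) \<omega> / real (Suc j ^ 4)) \<longlonglongrightarrow> \<mu>" by simp
    then have "(\<lambda>k. S k \<omega> / real k) \<longlonglongrightarrow> \<mu>"
      using S_pos \<omega> S_mono by (intro monotone_ratio_tendsto[where s = "\<lambda>k. S k \<omega>"]) auto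
    then have "(\<lambda>k. S k \<omega> / real k / \<mu> - 1) \<longlonglongrightarrow> \<mu> / \<mu> - 1" using \<mu>_pos by (intro tendsto_intros) auto
    moreover have "eventually (\<lambda>k. S k \<omega> / real k / \<mu> - 1 = R k \<omega>) sequentially"
      using eventually_gt_at_top[of 0] by eventually_elim (simp add: R_def)
    ultimately show "(\<lambda>k. R k \<omega>) \<longlonglongrightarrow> 0" using \<mu>_pos by (simp add: tendsto_cong)
  qed
qed

text \<open>The almost sure bounds hold with a random L. Continuity of the measure from below fixes
  one deterministic L outside a small event, and a deterministic L is needed for \<kappa> n * L to
  vanish in the limit.\<close>

lemma good_event:
  assumes \<delta>: "0 < \<delta>" and \<eta>: "0 < \<eta>"
  shows "\<exists>G L. G \<in> sets M \<and> 0 \<le> L \<and> prob (space M - G) < \<eta> \<and>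
    (\<forall>\<omega>\<in>G. \<forall>k. \<bar>R k \<omega>\<bar> \<le> L) \<and>
    (\<forall>\<omega>\<in>G. \<forall>n. (\<Sum>k=1..n. \<bar>ln (1 + R k \<omega>) - R k \<omega>\<bar> + \<bar>R k \<omega>\<bar> / real k) \<le> L + \<delta> * (\<Sum>k=1..n. \<bar>R k \<omega>\<bar>))"
proof -
  define G where "G L = {\<omega>\<in>space M. (\<forall>k. \<bar>R k \<omega>\<bar> \<le> real L) \<and>
    (\<forall>n. (\<Sum>k=1..n. \<bar>ln (1 + R k \<omega>) - R k \<omega>\<bar> + \<bar>R k \<omega>\<bar> / real k) \<le> real L + \<delta> * (\<Sum>k=1..n. \<bar>R k \<omega>\<bar>))}" for L :: nat
  have G_sets: "G L \<in> sets M" for L unfolding G_def by measurable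
  have "incseq G"
    unfolding incseq_def G_def by (auto intro: order_trans)
  then have "(\<lambda>L. prob (G L)) \<longlonglongrightarrow> prob (\<Union>L. G L)"
    using G_sets by (intro finite_Lim_measure_incseq) auto
  moreover have "AE \<omega> in M. \<omega> \<in> (\<Union>L. G L)"
    using R_tendsto_0
  proof (rule AE_mp, intro AE_I2 impI)
    fix \<omega> assume \<omega>: "\<omega> \<in> space M" "(\<lambda>k. R k \<omega>) \<longlonglongrightarrow> 0"
    show "\<omega> \<in> (\<Union>L. G L)"
      using log_error_linear_bound[OF \<omega>(2) \<delta>] \<omega>(1) unfolding G_def by blast
  qed
  then have "prob (\<Union>L. G L) = 1" using G_sets by (subst prob_eq_1) auto
  ultimately have "eventually (\<lambda>L. 1 - \<eta> < prob (G L)) sequentially"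
    using \<eta> by (intro order_tendstoD(1)) auto
  then obtain L where L: "1 - \<eta> < prob (G L)" by (auto simp: eventually_sequentially)
  show ?thesis
  proof (intro exI[of _ "G L"] exI[of _ "real L"] conjI)
    show "prob (space M - G L) < \<eta>" using L prob_compl[OF G_sets[of L]] by simp
  qed (use G_sets in \<open>auto simp: G_def\<close>)
qed

section \<open>Approximating the logarithmic path by truncated integrals\<close>

lemma log_path_in_D01: "log_path n \<omega> \<in> D01"
  unfolding log_path_fun by (rule grid_step_in_D01[where z = "\<lambda>m. \<kappa> n * (\<Sum>k=1..m. ln (1 + R k \<omega>))"])

lemma sum_path_in_D01: "sum_path n \<omega> \<in> D01"
  unfolding sum_path_fun by (rule grid_step_in_D01[where z = "\<lambda>m. \<kappa> n * (real m * R m \<omega>)"])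

lemma log_path_functional_measurable:
  assumes "unif_continuous_D g" shows "(\<lambda>\<omega>. g (log_path n \<omega>)) \<in> borel_measurable M"
  unfolding log_path_fun
  by (rule grid_step_functional_measurable[OF assms, where z = "\<lambda>m \<omega>. \<kappa> n * (\<Sum>k=1..m. ln (1 + R k \<omega>))"]) measurable

lemma cutoff_sum_path_functional_measurable:
  assumes g: "unif_continuous_D g" and \<epsilon>: "0 < \<epsilon>"
  shows "(\<lambda>\<omega>. g (cutoff_integral \<epsilon> (sum_path n \<omega>))) \<in> borel_measurable M"
proof (rule continuous_functional_measurable[OF g])
  show "continuous_on {0..1} (cutoff_integral \<epsilon> (sum_path n \<omega>))" for \<omega>
    by (rule cutoff_integral_continuous[OF sum_path_in_D01 \<epsilon>])
  fix t :: real
  have [measurable]: "(\<lambda>(\<omega>, s). sum_path n \<omega> s) \<in> borel_measurable (M \<Otimes>\<^sub>M lborel)"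
    unfolding sum_path_fun
    by (rule grid_step_joint_measurable[where z = "\<lambda>m \<omega>. \<kappa> n * (real m * R m \<omega>)"]) measurable
  have "(\<lambda>(\<omega>, s). sum_path n \<omega> (max 0 s)) \<in> borel_measurable (M \<Otimes>\<^sub>M lborel)"
    by measurable
  then show "(\<lambda>\<omega>. cutoff_integral \<epsilon> (sum_path n \<omega>) t) \<in> borel_measurable M"
    unfolding cutoff_integral_def by (rule weighted_integral_measurable[OF _ cutoff_weight_measurable])
qed

text \<open>Four errors of e/4 each: the exceptional event, the constant 3L damped by \<kappa> n,
  the logarithmic error governed by \<delta>, and the part below the cutoff. J is chosen before n,
  which may then depend on j.\<close>

lemma log_path_approximation:
  fixes g :: "(real \<Rightarrow> real) \<Rightarrow> real"
  assumes g: "unif_continuous_D g" and B: "\<And>x. x \<in> D01 \<Longrightarrow> \<bar>g x\<bar> \<le> B" and K: "0 \<le> K"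
    and lip: "\<And>x y r. \<lbrakk>x \<in> D01; y \<in> D01; 0 \<le> r; unif_close r x y\<rbrakk> \<Longrightarrow> \<bar>g x - g y\<bar> \<le> K * r"
    and e: "0 < e"
  shows "\<exists>J. \<forall>j\<ge>J. eventually (\<lambda>n. expectation (\<lambda>\<omega>. g (cutoff_integral (1 / real (Suc j)) (sum_path n \<omega>))) - e
      \<le> expectation (\<lambda>\<omega>. g (log_path n \<omega>))) sequentially"
proof -
  \<comment> \<open>The Lipschitz constant times \<kappa> n * \<open>sqrt n\<close> =
    \<mu>/\<sigma>, times the constant of \<open>R_sum_expectation\<close>.\<close>
  define A where "A = K * (\<mu> / \<sigma>) * (2 * C / \<mu>)"
  have A0: "0 \<le> A" using K C_nonneg \<mu>_pos \<sigma>_pos by (simp add: A_def)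
  have B0: "0 \<le> B" using order_trans[OF abs_ge_zero B[OF log_path_in_D01]] .
  \<comment> \<open>Adding 1 to A, and to B in \<eta>, keeps the denominators positive when A or B
    is 0.\<close>
  define \<delta> where "\<delta> = e / (4 * (A + 1))"
  have \<delta>: "0 < \<delta>" "A * \<delta> \<le> e / 4" using A0 e by (auto simp: \<delta>_def field_simps)
  define \<eta> where "\<eta> = e / (8 * (B + 1))"
  have \<eta>: "0 < \<eta>" "2 * B * \<eta> \<le> e / 4" using B0 e by (auto simp: \<eta>_def field_simps)
  obtain G L where G: "G \<in> sets M" "0 \<le> L" "prob (space M - G) < \<eta>"
    "\<forall>\<omega>\<in>G. \<forall>k. \<bar>R k \<omega>\<bar> \<le> L"
    "\<forall>\<omega>\<in>G. \<forall>n. (\<Sum>k=1..n. \<bar>ln (1 + R k \<omega>) - R k \<omega>\<bar> + \<bar>R k \<omega>\<bar> / real k) \<le> L + \<delta> * (\<Sum>k=1..n. \<bar>R k \<omega>\<bar>)"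
    using good_event[OF \<delta>(1) \<eta>(1)] by (elim exE conjE) (rule that)
  have "(\<lambda>j. A * sqrt (1 / real (Suc j))) \<longlonglongrightarrow> A * sqrt 0"
    by (intro tendsto_intros LIMSEQ_Suc[OF lim_1_over_n])
  then have "eventually (\<lambda>j. A * sqrt (1 / real (Suc j)) < e / 4) sequentially"
    using e by (intro order_tendstoD(2)) auto
  then obtain J where J: "\<And>j. j \<ge> J \<Longrightarrow> A * sqrt (1 / real (Suc j)) \<le> e / 4"
    by (auto simp: eventually_sequentially intro: less_imp_le)
  show ?thesis
  proof (intro exI[of _ J] allI impI)
    fix j assume j: "J \<le> j"
    define \<epsilon> where "\<epsilon> = 1 / real (Suc j)"
    have \<epsilon>: "0 < \<epsilon>" by (simp add: \<epsilon>_def)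
    have "filterlim (\<lambda>n. sqrt (real n)) at_top sequentially"
      by (rule filterlim_compose[OF sqrt_at_top filterlim_real_sequentially])
    then have "(\<lambda>n. K * (\<mu> / \<sigma>) * (3 * L) / sqrt (real n)) \<longlonglongrightarrow> 0"
      by (rule real_tendsto_divide_at_top[OF tendsto_const])
    then have "eventually (\<lambda>n. K * (\<mu> / \<sigma>) * (3 * L) / sqrt (real n) < e / 4) sequentially"
      using e by (intro order_tendstoD(2)) auto
    then show "eventually (\<lambda>n. expectation (\<lambda>\<omega>. g (cutoff_integral (1 / real (Suc j)) (sum_path n \<omega>))) - e
      \<le> expectation (\<lambda>\<omega>. g (log_path n \<omega>))) sequentially"
      using eventually_gt_at_top[of 0]
    proof eventually_elim
      case (elim n)
      define m where "m = nat \<lfloor>\<epsilon> * real n\<rfloor>"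
      \<comment> \<open>Outside G two values of g differ by at most 2B; on G the Lipschitz bound
        applies. The second term is nonnegative and is kept on the whole space, so that its mean
        follows directly from the moment bounds.\<close>
      define err where "err \<omega> = 2 * B * indicator (space M - G) \<omega> +
        K * \<kappa> n * (3 * L + \<delta> * (\<Sum>k=1..n. \<bar>R k \<omega>\<bar>) + (\<Sum>k=1..m. \<bar>R k \<omega>\<bar>))" for \<omega>
      have U_D: "cutoff_integral \<epsilon> (sum_path n \<omega>) \<in> D01" for \<omega>
        by (rule cutoff_integral_in_D01[OF sum_path_in_D01 \<epsilon>])
      have pw: "g (cutoff_integral \<epsilon> (sum_path n \<omega>)) - err \<omega> \<le> g (log_path n \<omega>)" if \<omega>: "\<omega> \<in> space M" for \<omega>
      proof (cases "\<omega> \<in> G")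
        case True
        have r: "0 \<le> \<kappa> n * (3 * L + \<delta> * (\<Sum>k=1..n. \<bar>R k \<omega>\<bar>) + (\<Sum>k=1..m. \<bar>R k \<omega>\<bar>))"
          using G(2) \<delta> \<kappa>_nonneg by (intro mult_nonneg_nonneg add_nonneg_nonneg sum_nonneg) auto
        have "unif_close (\<kappa> n * (3 * L + \<delta> * (\<Sum>k=1..n. \<bar>R k \<omega>\<bar>) + (\<Sum>k=1..m. \<bar>R k \<omega>\<bar>)))
           (log_path n \<omega>) (cutoff_integral \<epsilon> (sum_path n \<omega>))"
          unfolding log_path_fun sum_path_fun m_def
          using elim(2) by (intro log_sum_cutoff_error \<epsilon> \<kappa>_nonneg G(4,5)[rule_format] True)
        from lip[OF log_path_in_D01 U_D r this] show ?thesis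
          using True by (simp add: err_def mult.assoc)
      next
        case False
        have "0 \<le> K * \<kappa> n * (3 * L + \<delta> * (\<Sum>k=1..n. \<bar>R k \<omega>\<bar>) + (\<Sum>k=1..m. \<bar>R k \<omega>\<bar>))"
          using G(2) \<delta> \<kappa>_nonneg K by (intro mult_nonneg_nonneg add_nonneg_nonneg sum_nonneg) auto
        then show ?thesis using False \<omega> B[OF log_path_in_D01[of n \<omega>]] B[OF U_D[of \<omega>]] by (simp add: err_def)
      qed
      have err_int: "integrable M err"
        unfolding err_def using R_integrable G(1) by (intro Bochner_Integration.integrable_add integrable_mult_right integrable_sum integrable_real_indicator integrable_const) (auto simp: emeasure_eq_measure)
      have U_int: "integrable M (\<lambda>\<omega>. g (cutoff_integral \<epsilon> (sum_path n \<omega>)))"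
        using cutoff_sum_path_functional_measurable[OF g \<epsilon>] B[OF U_D] by (intro integrable_const_bound[of _ B]) auto
      have Z_int: "integrable M (\<lambda>\<omega>. g (log_path n \<omega>))"
        using log_path_functional_measurable[OF g] B[OF log_path_in_D01] by (intro integrable_const_bound[of _ B]) auto
      have "expectation (\<lambda>\<omega>. g (cutoff_integral \<epsilon> (sum_path n \<omega>))) - expectation err =
          expectation (\<lambda>\<omega>. g (cutoff_integral \<epsilon> (sum_path n \<omega>)) - err \<omega>)"
        using U_int err_int by simp
      also have "\<dots> \<le> expectation (\<lambda>\<omega>. g (log_path n \<omega>))"
        using U_int err_int Z_int pw by (intro integral_mono) auto
      finally have main: "expectation (\<lambda>\<omega>. g (cutoff_integral \<epsilon> (sum_path n \<omega>))) - expectation err \<le> expectation (\<lambda>\<omega>. g (log_path n \<omega>))" .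
      have "expectation err = 2 * B * prob (space M - G) + K * \<kappa> n *
          (3 * L + \<delta> * expectation (\<lambda>\<omega>. \<Sum>k=1..n. \<bar>R k \<omega>\<bar>) + expectation (\<lambda>\<omega>. \<Sum>k=1..m. \<bar>R k \<omega>\<bar>))"
      proof -
        define s where "s n \<omega> = (\<Sum>k=1..n. \<bar>R k \<omega>\<bar>)" for n \<omega>
        have "integrable M (s n)" for n
          unfolding s_def by (intro Bochner_Integration.integrable_sum R_integrable)
        moreover have "integrable M (indicat_real (space M - G))"
          using G(1) by (intro integrable_real_indicator) (auto simp: emeasure_eq_measure)
        ultimately show ?thesis
          unfolding err_def s_def[symmetric] using G(1) by (simp add: prob_space)
      qed
      also have "\<dots> \<le> 2 * B * \<eta> + K * \<kappa> n * (3 * L + \<delta> * (2 * C / \<mu> * sqrt (real n)) + 2 * C / \<mu> * sqrt (\<epsilon> * real n))"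
      proof -
        have "real m \<le> \<epsilon> * real n" unfolding m_def using \<epsilon> by simp
        then have "2 * C / \<mu> * sqrt (real m) \<le> 2 * C / \<mu> * sqrt (\<epsilon> * real n)"
          using C_nonneg \<mu>_pos by (intro mult_left_mono) auto
        then show ?thesis
          using G(3) B0 K \<kappa>_nonneg[of n] \<delta>(1) R_sum_expectation[of n] R_sum_expectation[of m]
          by (intro add_mono mult_left_mono) auto
      qed
      \<comment> \<open>Here \<kappa> n cancels \<open>sqrt n\<close>, so only the 3L term still
        depends on n.\<close>
      also have "\<dots> = 2 * B * \<eta> + K * (\<mu> / \<sigma>) * (3 * L) / sqrt (real n) + A * \<delta> + A * sqrt \<epsilon>"
        using elim(2) \<sigma>_pos \<mu>_pos unfolding A_def \<kappa>_def real_sqrt_mult by (simp add: field_simps)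
      also have "\<dots> \<le> e" using \<eta>(2) \<delta>(2) J[OF j] elim(1) unfolding \<epsilon>_def by linarith
      finally show ?case using main unfolding \<epsilon>_def by linarith
    qed
  qed
qed

end

section \<open>Functionals of the Wiener integral and removal of its cutoff\<close>

lemma wiener_cutoff_functional_measurable:
  assumes W: "standard_wiener_process N W" and g: "unif_continuous_D g" and \<epsilon>: "0 < \<epsilon>"
  shows "(\<lambda>\<omega>. g (cutoff_integral \<epsilon> (\<lambda>t. W t \<omega>))) \<in> borel_measurable N"
proof (rule continuous_functional_measurable[OF g])
  fix \<omega> assume "\<omega> \<in> space N"
  then have "continuous_on {0..} (\<lambda>t. W t \<omega>)" using W unfolding standard_wiener_process_def by blast
  then show "continuous_on {0..1} (cutoff_integral \<epsilon> (\<lambda>t. W t \<omega>))"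
    by (intro cutoff_integral_continuous continuous_imp_D01 \<epsilon>) (auto elim: continuous_on_subset)
next
  fix t :: real
  show "(\<lambda>\<omega>. cutoff_integral \<epsilon> (\<lambda>t. W t \<omega>) t) \<in> borel_measurable N"
    unfolding cutoff_integral_def
    by (rule weighted_integral_measurable[of "\<lambda>\<omega> t. W t \<omega>", OF wiener_joint_measurable[OF W] cutoff_weight_measurable])
qed

lemma wiener_div_integral_continuous:
  assumes W: "standard_wiener_process N W" and \<omega>: "\<omega> \<in> space N"
  shows "continuous_on {0..1} (\<lambda>t. LINT s:{0..t}|lborel. W s \<omega> / s)"
proof -
  have "continuous_on {0..} (\<lambda>t. W t \<omega>)" using W \<omega> unfolding standard_wiener_process_def by blast
  then show ?thesis by (intro div_integral_continuous) (auto elim: continuous_on_subset)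
qed

lemma wiener_div_functional_measurable:
  assumes W: "standard_wiener_process N W" and g: "unif_continuous_D g"
  shows "(\<lambda>\<omega>. g (\<lambda>t. LINT s:{0..t}|lborel. W s \<omega> / s)) \<in> borel_measurable N"
proof (rule continuous_functional_measurable[OF g wiener_div_integral_continuous[OF W]])
  fix t :: real
  have "(\<lambda>\<omega>. LINT s:{0..t}|lborel. W s \<omega> * (1 / s)) \<in> borel_measurable N"
    by (rule weighted_integral_measurable[of "\<lambda>\<omega> t. W t \<omega>", OF wiener_joint_measurable[OF W]]) measurable
  then show "(\<lambda>\<omega>. LINT s:{0..t}|lborel. W s \<omega> / s) \<in> borel_measurable N" by simp
qed

text \<open>For almost every outcome the truncated paths converge uniformly, by integrability of W s
  / s; continuity and boundedness of g then allow dominated convergence.\<close>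

lemma wiener_cutoff_tendsto:
  assumes W: "standard_wiener_process N W" and g: "unif_continuous_D g"
    and B: "\<And>x. x \<in> D01 \<Longrightarrow> \<bar>g x\<bar> \<le> B"
  shows "(\<lambda>j. \<integral>\<omega>. g (cutoff_integral (1 / real (Suc j)) (\<lambda>t. W t \<omega>)) \<partial>N)
    \<longlonglongrightarrow> (\<integral>\<omega>. g (\<lambda>t. LINT s:{0..t}|lborel. W s \<omega> / s) \<partial>N)"
proof -
  interpret N: prob_space N using W by (simp add: standard_wiener_process_def)
  have W_cont: "continuous_on {0..1} (\<lambda>t. W t \<omega>)" if "\<omega> \<in> space N" for \<omega>
  proof -
    have "continuous_on {0..} (\<lambda>t. W t \<omega>)" using W that unfolding standard_wiener_process_def by blast
    then show ?thesis by (rule continuous_on_subset) auto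
  qed
  have U_D: "cutoff_integral (1 / real (Suc j)) (\<lambda>t. W t \<omega>) \<in> D01" if "\<omega> \<in> space N" for \<omega> j
    by (intro cutoff_integral_in_D01 continuous_imp_D01 W_cont that) simp
  show ?thesis
  proof (rule integral_dominated_convergence[where w = "\<lambda>_. B"])
    show "(\<lambda>\<omega>. g (\<lambda>t. LINT s:{0..t}|lborel. W s \<omega> / s)) \<in> borel_measurable N"
      by (rule wiener_div_functional_measurable[OF W g])
    show "(\<lambda>\<omega>. g (cutoff_integral (1 / real (Suc j)) (\<lambda>t. W t \<omega>))) \<in> borel_measurable N" for j
      by (rule wiener_cutoff_functional_measurable[OF W g]) simp
    show "AE \<omega> in N. norm (g (cutoff_integral (1 / real (Suc j)) (\<lambda>t. W t \<omega>))) \<le> B" for j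
      by (intro AE_I2) (use B[OF U_D] in simp)
    show "AE \<omega> in N. (\<lambda>j. g (cutoff_integral (1 / real (Suc j)) (\<lambda>t. W t \<omega>))) \<longlonglongrightarrow> g (\<lambda>t. LINT s:{0..t}|lborel. W s \<omega> / s)"
      using wiener_AE_div_integrable[OF W]
    proof (rule AE_mp, intro AE_I2 impI)
      fix \<omega> assume \<omega>: "\<omega> \<in> space N" and int: "set_integrable lborel {0..1} (\<lambda>s. W s \<omega> / s)"
      let ?V = "\<lambda>t. LINT s:{0..t}|lborel. W s \<omega> / s"
      have V_D: "?V \<in> D01" by (rule continuous_imp_D01[OF wiener_div_integral_continuous[OF W \<omega>]])
      show "(\<lambda>j. g (cutoff_integral (1 / real (Suc j)) (\<lambda>t. W t \<omega>))) \<longlonglongrightarrow> g ?V"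
      proof (rule tendstoI)
        fix e :: real assume "0 < e"
        then obtain d where d: "d > 0" "\<And>y. y \<in> D01 \<Longrightarrow> unif_close d ?V y \<Longrightarrow> \<bar>g y - g ?V\<bar> < e"
          using g V_D unfolding unif_continuous_D_def by meson
        from cutoff_integral_tendsto[OF W_cont[OF \<omega>] int d(1)]
        show "eventually (\<lambda>j. dist (g (cutoff_integral (1 / real (Suc j)) (\<lambda>t. W t \<omega>))) (g ?V) < e) sequentially"
        proof eventually_elim
          case (elim j)
          from d(2)[OF U_D[OF \<omega>] elim] show ?case by (simp only: dist_real_def)
        qed
      qed
    qed
  qed simp
qed

section \<open>Passage to the limit\<close>

context monotone_sums
begin

text \<open>Four losses of e/4: passing to the envelope at the limit, cutting off the Wiener
  integral, the convergence hypothesis, and the approximation of the logarithmic path. The return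
  from the envelope to g costs nothing in this direction.\<close>

lemma log_path_liminf:
  assumes W: "standard_wiener_process N W"
    and conv: "conv_distr_D M sum_path N (\<lambda>\<omega> t. W t \<omega>)"
    and g: "unif_continuous_D g" and B: "\<And>x. x \<in> D01 \<Longrightarrow> \<bar>g x\<bar> \<le> B" and e: "0 < e"
  shows "eventually (\<lambda>n. (\<integral>\<omega>. g (\<lambda>t. LINT s:{0..t}|lborel. W s \<omega> / s) \<partial>N) - e
    < expectation (\<lambda>\<omega>. g (log_path n \<omega>))) sequentially"
proof -
  interpret N: prob_space N using W by (simp add: standard_wiener_process_def)
  define V where "V = (\<lambda>\<omega> t. LINT s:{0..t}|lborel. W s \<omega> / s)"
  have V_D: "V \<omega> \<in> D01" if "\<omega> \<in> space N" for \<omega>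
    unfolding V_def by (rule continuous_imp_D01[OF wiener_div_integral_continuous[OF W that]])
  have V_meas: "(\<lambda>\<omega>. h (V \<omega>)) \<in> borel_measurable N" if "unif_continuous_D h" for h
    unfolding V_def by (rule wiener_div_functional_measurable[OF W that])
  let ?g = "\<lambda>k. lip_envelope (real k) g"
  have gk: "unif_continuous_D (?g k)" for k by (rule lip_envelope_unif_continuous[OF B]) auto
  have gB: "\<bar>?g k x\<bar> \<le> B" if "x \<in> D01" for k x by (rule lip_envelope_bounded[OF B _ that]) auto
  have "(\<lambda>k. \<integral>\<omega>. ?g k (V \<omega>) \<partial>N) \<longlonglongrightarrow> (\<integral>\<omega>. g (V \<omega>) \<partial>N)"
  proof (rule integral_dominated_convergence[where w = "\<lambda>_. B"])
    show "AE \<omega> in N. (\<lambda>k. ?g k (V \<omega>)) \<longlonglongrightarrow> g (V \<omega>)"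
      by (intro AE_I2 lip_envelope_tendsto[OF B g V_D])
    show "AE \<omega> in N. norm (?g k (V \<omega>)) \<le> B" for k
      by (intro AE_I2) (use gB[OF V_D] in simp)
  qed (use V_meas g gk in auto)
  then have "eventually (\<lambda>k. (\<integral>\<omega>. g (V \<omega>) \<partial>N) - e / 4 < (\<integral>\<omega>. ?g k (V \<omega>) \<partial>N)) sequentially"
    using e by (intro order_tendstoD(1)) auto
  then obtain k where k: "(\<integral>\<omega>. g (V \<omega>) \<partial>N) - e / 4 < (\<integral>\<omega>. ?g k (V \<omega>) \<partial>N)"
    by (auto simp: eventually_sequentially)
  obtain J where J: "\<forall>j\<ge>J. eventually (\<lambda>n. expectation (\<lambda>\<omega>. ?g k (cutoff_integral (1 / real (Suc j)) (sum_path n \<omega>))) - e / 4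
      \<le> expectation (\<lambda>\<omega>. ?g k (log_path n \<omega>))) sequentially"
    using log_path_approximation[OF gk gB of_nat_0_le_iff lip_envelope_lipschitz[OF B of_nat_0_le_iff], of "e / 4" k] e
    by auto
  have "eventually (\<lambda>j. (\<integral>\<omega>. ?g k (V \<omega>) \<partial>N) - e / 4 < (\<integral>\<omega>. ?g k (cutoff_integral (1 / real (Suc j)) (\<lambda>t. W t \<omega>)) \<partial>N)) sequentially"
    unfolding V_def using e by (intro order_tendstoD(1)[OF wiener_cutoff_tendsto[OF W gk gB]]) auto
  \<comment> \<open>j must exceed J and also make the cutoff of the Wiener integral harmless. It is
    fixed before n grows, since the hypothesis concerns one functional at a time.\<close>
  then obtain j where j: "J \<le> j" "(\<integral>\<omega>. ?g k (V \<omega>) \<partial>N) - e / 4 < (\<integral>\<omega>. ?g k (cutoff_integral (1 / real (Suc j)) (\<lambda>t. W t \<omega>)) \<partial>N)"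
    unfolding eventually_sequentially by (meson le_cases order_trans)
  define \<epsilon> where "\<epsilon> = 1 / real (Suc j)"
  have \<epsilon>: "0 < \<epsilon>" by (simp add: \<epsilon>_def)
  let ?h = "\<lambda>x. ?g k (cutoff_integral \<epsilon> x)"
  have "skorokhod_continuous ?h" by (rule skorokhod_continuous_cutoff[OF gk \<epsilon>])
  moreover have "\<forall>x\<in>D01. \<bar>?h x\<bar> \<le> B" using gB cutoff_integral_in_D01[OF _ \<epsilon>] by blast
  ultimately have "(\<lambda>n. integral\<^sup>L (completion M) (\<lambda>\<omega>. ?h (sum_path n \<omega>))) \<longlonglongrightarrow> integral\<^sup>L (completion N) (\<lambda>\<omega>. ?h (\<lambda>t. W t \<omega>))"
    using conv unfolding conv_distr_D_def by blast
  \<comment> \<open>Measurability for the original measures permits replacing integrals over the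
    completions.\<close>
  then have "(\<lambda>n. expectation (\<lambda>\<omega>. ?h (sum_path n \<omega>))) \<longlonglongrightarrow> (\<integral>\<omega>. ?h (\<lambda>t. W t \<omega>) \<partial>N)"
    by (simp add: integral_completion cutoff_sum_path_functional_measurable[OF gk \<epsilon>] wiener_cutoff_functional_measurable[OF W gk \<epsilon>])
  then have "eventually (\<lambda>n. (\<integral>\<omega>. ?h (\<lambda>t. W t \<omega>) \<partial>N) - e / 4 < expectation (\<lambda>\<omega>. ?h (sum_path n \<omega>))) sequentially"
    using e by (intro order_tendstoD(1)) auto
  with J[rule_format, OF j(1)] show ?thesis
  proof eventually_elim
    case (elim n)
    have "expectation (\<lambda>\<omega>. ?g k (log_path n \<omega>)) \<le> expectation (\<lambda>\<omega>. g (log_path n \<omega>))"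
    proof (rule integral_mono)
      show "integrable M (\<lambda>\<omega>. ?g k (log_path n \<omega>))" "integrable M (\<lambda>\<omega>. g (log_path n \<omega>))"
        using gB[OF log_path_in_D01] B[OF log_path_in_D01] log_path_functional_measurable[OF gk] log_path_functional_measurable[OF g]
        by (auto intro!: integrable_const_bound[of _ B])
      show "?g k (log_path n \<omega>) \<le> g (log_path n \<omega>)" for \<omega>
        by (rule lip_envelope_le[OF B _ log_path_in_D01]) auto
    qed
    with elim j(2) k show ?case unfolding \<epsilon>_def V_def by linarith
  qed
qed

lemma log_path_tendsto:
  assumes W: "standard_wiener_process N W"
    and conv: "conv_distr_D M sum_path N (\<lambda>\<omega> t. W t \<omega>)"
    and g: "unif_continuous_D g" and B: "\<And>x. x \<in> D01 \<Longrightarrow> \<bar>g x\<bar> \<le> B"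
  shows "(\<lambda>n. expectation (\<lambda>\<omega>. g (log_path n \<omega>))) \<longlonglongrightarrow> (\<integral>\<omega>. g (\<lambda>t. LINT s:{0..t}|lborel. W s \<omega> / s) \<partial>N)"
proof (rule tendstoI)
  fix e :: real assume e: "0 < e"
  have g': "unif_continuous_D (\<lambda>x. - g x)"
    using g unfolding unif_continuous_D_def by (simp add: abs_minus_commute)
  have "eventually (\<lambda>n. (\<integral>\<omega>. g (\<lambda>t. LINT s:{0..t}|lborel. W s \<omega> / s) \<partial>N) - e
      < expectation (\<lambda>\<omega>. g (log_path n \<omega>))) sequentially"
    by (rule log_path_liminf[OF W conv g B e])
  moreover have "eventually (\<lambda>n. (\<integral>\<omega>. - g (\<lambda>t. LINT s:{0..t}|lborel. W s \<omega> / s) \<partial>N) - e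
      < expectation (\<lambda>\<omega>. - g (log_path n \<omega>))) sequentially"
    by (rule log_path_liminf[OF W conv g' _ e, of B]) (use B in simp)
  ultimately show "eventually (\<lambda>n. dist (expectation (\<lambda>\<omega>. g (log_path n \<omega>))) (\<integral>\<omega>. g (\<lambda>t. LINT s:{0..t}|lborel. W s \<omega> / s) \<partial>N) < e) sequentially"
    by eventually_elim (simp add: dist_real_def abs_less_iff)
qed

text \<open>A continuous mapping argument: a test functional f is pulled back along exp, which turns
  the product into the logarithmic path and the limit into the plain integral.\<close>

lemma exp_log_path_conv_distr:
  assumes W: "standard_wiener_process N W"
    and conv: "conv_distr_D M sum_path N (\<lambda>\<omega> t. W t \<omega>)"
  shows "conv_distr_D M (\<lambda>n \<omega> t. (\<Prod>k\<in>{1..nat \<lfloor>real n * t\<rfloor>}. S k \<omega> / (real k * \<mu>)) powr ((\<mu> / \<sigma>) / sqrt (real n)))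
    N (\<lambda>\<omega> t. exp (LINT x:{0..t}|lborel. W x \<omega> / x))"
  unfolding conv_distr_D_def
proof (intro conjI allI impI)
  let ?P = "\<lambda>n \<omega> t. (\<Prod>k\<in>{1..nat \<lfloor>real n * t\<rfloor>}. S k \<omega> / (real k * \<mu>)) powr ((\<mu> / \<sigma>) / sqrt (real n))"
  have exp_D: "(\<lambda>t. exp (x t)) \<in> D01" if "x \<in> D01" for x
    using D01_compose_continuous[OF that, of exp] by (simp add: continuous_on_exp)
  have P_eq: "?P n \<omega> = (\<lambda>t. exp (log_path n \<omega> t))" if "\<omega> \<in> space M" for n \<omega>
    using exp_log_path[OF that] by (intro ext) simp
  show "AE \<omega> in M. ?P n \<omega> \<in> D01" for n
    by (rule AE_I2) (simp only: P_eq exp_D[OF log_path_in_D01])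
  show "AE \<omega> in N. (\<lambda>t. exp (LINT x:{0..t}|lborel. W x \<omega> / x)) \<in> D01"
    by (intro AE_I2 exp_D continuous_imp_D01 wiener_div_integral_continuous[OF W])
  fix f assume "skorokhod_continuous f \<and> (\<exists>B. \<forall>x\<in>D01. \<bar>f x\<bar> \<le> B)"
  then obtain B where f: "skorokhod_continuous f" and B: "\<And>x. x \<in> D01 \<Longrightarrow> \<bar>f x\<bar> \<le> B" by blast
  define g where "g x = f (\<lambda>t. exp (x t))" for x
  have g: "unif_continuous_D g" unfolding g_def by (rule skorokhod_continuous_exp[OF f])
  have gB: "\<bar>g x\<bar> \<le> B" if "x \<in> D01" for x unfolding g_def by (rule B[OF exp_D[OF that]])
  have "integral\<^sup>L (completion M) (\<lambda>\<omega>. f (?P n \<omega>)) = expectation (\<lambda>\<omega>. g (log_path n \<omega>))" for n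
  proof -
    have "integral\<^sup>L (completion M) (\<lambda>\<omega>. f (?P n \<omega>)) = integral\<^sup>L (completion M) (\<lambda>\<omega>. g (log_path n \<omega>))"
      by (intro Bochner_Integration.integral_cong refl) (simp only: space_completion P_eq g_def)
    also have "\<dots> = expectation (\<lambda>\<omega>. g (log_path n \<omega>))"
      by (rule integral_completion[OF log_path_functional_measurable[OF g]])
    finally show ?thesis .
  qed
  moreover have "integral\<^sup>L (completion N) (\<lambda>\<omega>. f (\<lambda>t. exp (LINT x:{0..t}|lborel. W x \<omega> / x))) =
      (\<integral>\<omega>. g (\<lambda>t. LINT x:{0..t}|lborel. W x \<omega> / x) \<partial>N)"
    using integral_completion[OF wiener_div_functional_measurable[OF W g]] by (simp only: g_def)
  ultimately show "(\<lambda>n. integral\<^sup>L (completion M) (\<lambda>\<omega>. f (?P n \<omega>)))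
      \<longlonglongrightarrow> integral\<^sup>L (completion N) (\<lambda>\<omega>. f (\<lambda>t. exp (LINT x:{0..t}|lborel. W x \<omega> / x)))"
    using log_path_tendsto[OF W conv g gB] by simp
qed

end

theorem theorem1p1:
  fixes M :: "'a measure" and N :: "'b measure"
    and S :: "nat \<Rightarrow> 'a \<Rightarrow> real" and W :: "real \<Rightarrow> 'b \<Rightarrow> real"
    and \<mu> \<sigma> :: real
  assumes "prob_space M"
    and "\<forall>k\<ge>1. S k \<in> borel_measurable M"
    and "\<forall>k\<ge>1. \<forall>\<omega>\<in>space M. 0 < S k \<omega>"
    and "\<forall>k\<ge>1. \<forall>\<omega>\<in>space M. S k \<omega> \<le> S (Suc k) \<omega>"
    and "standard_wiener_process N W"
    and "0 < \<mu>" and "0 < \<sigma>"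
    and "conv_distr_D M
           (\<lambda>n \<omega> t. ((if nat \<lfloor>real n * t\<rfloor> = 0 then 0 else S (nat \<lfloor>real n * t\<rfloor>) \<omega>)
                       - real (nat \<lfloor>real n * t\<rfloor>) * \<mu>) / (\<sigma> * sqrt (real n)))
           N (\<lambda>\<omega> t. W t \<omega>)"
    and "\<exists>C::real. \<forall>n\<ge>1. (\<integral>\<^sup>+\<omega>. ennreal \<bar>S n \<omega> - real n * \<mu>\<bar> \<partial>M) \<le> ennreal (C * sqrt (real n))"
  shows "conv_distr_D M
           (\<lambda>n \<omega> t. (\<Prod>k\<in>{1..nat \<lfloor>real n * t\<rfloor>}. S k \<omega> / (real k * \<mu>)) powr ((\<mu> / \<sigma>) / sqrt (real n)))
           N (\<lambda>\<omega> t. exp (LINT x:{0..t}|lborel. W x \<omega> / x))"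
proof -
  obtain C where C: "\<And>n. 1 \<le> n \<Longrightarrow> (\<integral>\<^sup>+\<omega>. ennreal \<bar>S n \<omega> - real n * \<mu>\<bar> \<partial>M) \<le> ennreal (C * sqrt (real n))"
    using assms(9) by blast
  \<comment> \<open>The given constant may be negative; its absolute value meets the sign condition
    of the locale.\<close>
  have "(\<integral>\<^sup>+\<omega>. ennreal \<bar>S n \<omega> - real n * \<mu>\<bar> \<partial>M) \<le> ennreal (\<bar>C\<bar> * sqrt (real n))" if "1 \<le> n" for n
    by (rule order_trans[OF C[OF that]]) (auto intro!: ennreal_leI mult_right_mono)
  then interpret monotone_sums M S \<mu> \<sigma> "\<bar>C\<bar>"
    using assms by (intro monotone_sums.intro monotone_sums_axioms.intro) auto
  have "sum_path = (\<lambda>n \<omega> t. ((if nat \<lfloor>real n * t\<rfloor> = 0 then 0 else S (nat \<lfloor>real n * t\<rfloor>) \<omega>)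
                       - real (nat \<lfloor>real n * t\<rfloor>) * \<mu>) / (\<sigma> * sqrt (real n)))"
    by (intro ext) (rule sum_path_eq)
  with assms(8) have "conv_distr_D M sum_path N (\<lambda>\<omega> t. W t \<omega>)" by simp
  then show ?thesis by (rule exp_log_path_conv_distr[OF assms(5)])
qed

end
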